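(* Let $\gamma\in\mathbb{R}$, $n\in\mathbb{N}$, $n\geq 2$, and $f\in C_0^\infty(\mathbb{R}^n\backslash\{0\})$. Then $$\int_{\mathbb{R}^n} |x|^\gamma|(\Delta f)(x)|^2\, d^nx\geq A_{n,\gamma}\int_{\mathbb{R}^n}|x|^{\gamma-2}|(\nabla f)(x)|^2\, d^nx,$$ where $A_{n,\gamma}=\min_{j\in\mathbb{N}_0}\{\alpha_{n,\gamma,\lambda_j}\}$, with $\lambda_j=j(j+n-2)$, $j\in\mathbb{N}_0$, and $$\alpha_{n,\gamma,\lambda_0}=\alpha_{n,\gamma,0}=4^{-1}(n-\gamma)^2,\qquad \alpha_{n,\gamma,\lambda_j}=\frac{\big[4^{-1}(n+\gamma-4)(n-\gamma)+\lambda_j\big]^2}{4^{-1}(n+\gamma-4)^2+\lambda_j},\quad j\in\mathbb{N}.$$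
   Context: $\mathbb{N}=\{1,2,\dots\}$, $\mathbb{N}_0=\mathbb{N}\cup\{0\}$. $C_0^\infty(\mathbb{R}^n\backslash\{0\})$ denotes the complex-valued infinitely differentiable functions with compact support contained in $\mathbb{R}^n\backslash\{0\}$. *)

theory Defs
  imports "HOL-Analysis.Analysis"
begin

section \<open>Smooth functions with compact support\<close>

text \<open>
  \<open>k\<close>-fold continuous differentiability on an open set \<open>S\<close>. On a finite-dimensional space,
  continuity of \<open>Df\<close> amounts to continuity of every directional derivative \<open>x \<mapsto> Df(x) v\<close>.
\<close>

primrec C_k_on :: "nat \<Rightarrow> 'a::euclidean_space set \<Rightarrow> ('a \<Rightarrow> 'b::real_normed_vector) \<Rightarrow> bool" where
  "C_k_on 0 S f \<longleftrightarrow> continuous_on S f"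
| "C_k_on (Suc k) S f \<longleftrightarrow>
     (\<forall>x\<in>S. f differentiable (at x)) \<and>
     (\<forall>v. C_k_on k S (\<lambda>x. frechet_derivative f (at x) v))"

definition smooth_on :: "'a::euclidean_space set \<Rightarrow> ('a \<Rightarrow> 'b::real_normed_vector) \<Rightarrow> bool" where
  "smooth_on S f \<longleftrightarrow> (\<forall>k. C_k_on k S f)"

text \<open>
  Elements of \<open>C\<^sub>0\<^sup>\<infinity>(\<Omega>)\<close>, \<open>\<Omega>\<close> open, are represented by their extensions by zero to the whole
  space. The closure is taken in the whole space, so that the support stays away from the
  boundary of \<open>\<Omega>\<close>.
\<close>

definition C0_infty :: "'a::euclidean_space set \<Rightarrow> ('a \<Rightarrow> complex) set" where
  "C0_infty \<Omega> = {f. smooth_on \<Omega> f \<and> compact (closure {x. f x \<noteq> 0}) \<and> closure {x. f x \<noteq> 0} \<subseteq> \<Omega>}"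


section \<open>Gradient and Laplacian\<close>

definition partial_deriv :: "'n \<Rightarrow> (real^'n \<Rightarrow> complex) \<Rightarrow> real^'n \<Rightarrow> complex" where
  "partial_deriv j f x = frechet_derivative f (at x) (axis j 1)"

text \<open>
  The norm on \<^typ>\<open>complex^'n\<close> is the Hermitian one, so the squared norm of the gradient is
  the sum of the squared moduli of the partial derivatives.
\<close>

definition gradient :: "(real^'n \<Rightarrow> complex) \<Rightarrow> real^'n \<Rightarrow> complex^'n" where
  "gradient f x = (\<chi> j. partial_deriv j f x)"

definition laplacian :: "(real^'n \<Rightarrow> complex) \<Rightarrow> real^'n \<Rightarrow> complex" where
  "laplacian f x = (\<Sum>j\<in>UNIV. partial_deriv j (partial_deriv j f) x)"


section \<open>The constants\<close>

definition sphere_eigenvalue :: "nat \<Rightarrow> nat \<Rightarrow> real" where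
  "sphere_eigenvalue n j = real j * (real j + real n - 2)"

definition alpha :: "nat \<Rightarrow> real \<Rightarrow> nat \<Rightarrow> real" where
  "alpha n \<gamma> j =
    (if j = 0 then (real n - \<gamma>)\<^sup>2 / 4
     else ((real n + \<gamma> - 4) * (real n - \<gamma>) / 4 + sphere_eigenvalue n j)\<^sup>2
          / ((real n + \<gamma> - 4)\<^sup>2 / 4 + sphere_eigenvalue n j))"

text \<open>
  A minimum over an infinite family, hence not expressible by \<^const>\<open>Min\<close>. That it is
  attained for \<open>n \<ge> 2\<close> is shown in \<open>A_const_is_minimum\<close>.
\<close>

definition A_const :: "nat \<Rightarrow> real \<Rightarrow> real" where
  "A_const n \<gamma> = (LEAST a. a \<in> range (alpha n \<gamma>))"

lemma alpha_lower_bound: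
  assumes "n \<ge> 2" "j \<ge> 1"
  shows "alpha n \<gamma> j \<ge>
    real j + 2 * ((real n + \<gamma> - 4) * (real n - \<gamma>) / 4) - (real n + \<gamma> - 4)\<^sup>2 / 4"
proof -
  define l b d where "l = sphere_eigenvalue n j"
    and "b = (real n + \<gamma> - 4) * (real n - \<gamma>) / 4" and "d = (real n + \<gamma> - 4)\<^sup>2 / 4"
  have "real j * 1 \<le> real j * (real j + real n - 2)"
    using assms by (intro mult_left_mono) auto
  then have l: "l \<ge> real j" by (simp add: l_def sphere_eigenvalue_def)
  have pos: "d + l > 0" using l assms by (simp add: d_def add_nonneg_pos)
  have "(l + 2 * b - d) * (d + l) \<le> (l + 2 * b - d) * (d + l) + (b - d)\<^sup>2" by simp
  also have "\<dots> = (b + l)\<^sup>2" by (simp add: power2_eq_square algebra_simps)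
  finally have "l + 2 * b - d \<le> (b + l)\<^sup>2 / (d + l)"
    using pos by (simp add: pos_le_divide_eq)
  moreover have "alpha n \<gamma> j = (b + l)\<^sup>2 / (d + l)"
    using assms by (simp add: alpha_def l_def b_def d_def)
  ultimately show ?thesis using l unfolding b_def d_def by linarith
qed

lemma A_const_is_minimum:
  assumes "n \<ge> 2"
  shows "A_const n \<gamma> \<in> range (alpha n \<gamma>)" and "A_const n \<gamma> \<le> alpha n \<gamma> j"
proof -
  define c where "c = 2 * ((real n + \<gamma> - 4) * (real n - \<gamma>) / 4) - (real n + \<gamma> - 4)\<^sup>2 / 4"
  define J where "J = {j. alpha n \<gamma> j \<le> alpha n \<gamma> 0}"
  have "j \<le> nat \<lceil>alpha n \<gamma> 0 - c\<rceil>" if "j \<in> J" for j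
  proof (cases "j = 0")
    case False
    then have "real j + c \<le> alpha n \<gamma> 0"
      using that alpha_lower_bound[OF assms, of j \<gamma>] by (simp add: J_def c_def)
    then show ?thesis by linarith
  qed simp
  then have "finite J" by (meson finite_nat_set_iff_bounded_le)
  moreover have "0 \<in> J" by (simp add: J_def)
  ultimately obtain m where m: "m \<in> J" "\<And>j. j \<in> J \<Longrightarrow> alpha n \<gamma> m \<le> alpha n \<gamma> j"
    using ex_min_if_finite[of "alpha n \<gamma> ` J"] by (force simp: not_less)
  have min: "alpha n \<gamma> m \<le> alpha n \<gamma> j" for j
    using m(2)[of j] m(2)[of 0] by (simp add: J_def) linarith
  have "A_const n \<gamma> = alpha n \<gamma> m"
    unfolding A_const_def by (rule Least_equality) (use min in auto)
  then show "A_const n \<gamma> \<in> range (alpha n \<gamma>)" "A_const n \<gamma> \<le> alpha n \<gamma> j"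
    using min by auto
qed

end

theory Submission
  imports Defs
begin

text \<open>
  Write \<open>L = - 1/2 \<Sum>\<^sub>i\<^sub>k (x\<^sub>i \<partial>\<^sub>k - x\<^sub>k \<partial>\<^sub>i)\<^sup>2\<close>, the spherical Laplacian made to act on functions on the
  whole space, and \<open>G = x \<cdot> \<nabla> + n/2\<close>. With \<open>u = |x|\<^bsup>(\<gamma>-4)/2\<^esup> f\<close>, \<open>s = (n+\<gamma>-4)/2\<close> and
  \<open>b = (n+\<gamma>-4)(n-\<gamma>)/4\<close> the two integrands are \<open>|G\<^sup>2u + (2-\<gamma>)Gu - bu - Lu|\<^sup>2\<close> and
  \<open>|Gu - su|\<^sup>2\<close> plus the angular part of \<open>|x|\<^sup>2|\<nabla>u|\<^sup>2\<close>. Since \<open>G\<close> is antisymmetric, \<open>L\<close> is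
  symmetric and nonnegative, and they commute, the difference of the integrals is at least
  \<open>((2-\<gamma>)\<^sup>2 + 2b - A) \<parallel>Gu\<parallel>\<^sup>2 + \<langle>p(L)u, u\<rangle>\<close> with \<open>p(\<lambda>) = (b+\<lambda>)\<^sup>2 - A(s\<^sup>2+\<lambda>)\<close>, and \<open>p \<ge> 0\<close> at every
  \<open>\<lambda>\<^sub>j\<close> by the choice of \<open>A\<close>.

  To get \<open>\<langle>p(L)u, u\<rangle> \<ge> 0\<close> it is enough to know \<open>\<langle>(L-\<lambda>\<^sub>j)(L-\<lambda>\<^sub>j\<^sub>+\<^sub>1)u, u\<rangle> \<ge> 0\<close> for all \<open>j\<close>: take the \<open>j\<close>
  for which \<open>\<langle>Lu, u\<rangle>/\<parallel>u\<parallel>\<^sup>2\<close> lies between \<open>\<lambda>\<^sub>j\<close> and \<open>\<lambda>\<^sub>j\<^sub>+\<^sub>1\<close>; the difference of the two quadratics is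
  affine and nonnegative at both ends. The spectral gap itself follows by duality from the
  density of polynomials, each of which is a sum of eigenfunctions of \<open>L\<close>.
\<close>

section \<open>Calculus of the classes \<open>C\<^sup>k\<close>\<close>

text \<open>On an open set derivatives depend only on nearby values, so equality on \<open>S\<close>
  passes to all iterated derivatives. A function can thus be replaced by a formula valid only on
  \<open>S\<close>.\<close>

lemma C_k_on_cong:
  assumes "open S" "\<And>x. x \<in> S \<Longrightarrow> f x = g x" "C_k_on k S f"
  shows "C_k_on k S g"
  using assms(2,3)
proof (induction k arbitrary: f g)
  case 0
  then show ?case using continuous_on_cong by force
next
  case (Suc k)
  have *: "(g has_derivative frechet_derivative f (at x)) (at x)" if "x \<in> S" for x
    using has_derivative_transform_within_open[OF _ assms(1) that, of f _ UNIV g] Suc.prems that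
    by (simp add: frechet_derivative_works)
  then have eq: "frechet_derivative f (at x) = frechet_derivative g (at x)" if "x \<in> S" for x
    using that frechet_derivative_at by blast
  have "C_k_on k S (\<lambda>x. frechet_derivative g (at x) v)" for v
    by (rule Suc.IH[of "\<lambda>x. frechet_derivative f (at x) v"]) (use Suc.prems eq in auto)
  then show ?case
    using * by (auto simp: differentiable_def)
qed

lemma C_k_on_Suc_imp: "C_k_on (Suc k) S f \<Longrightarrow> C_k_on k S f"
proof (induction k arbitrary: f)
  case 0
  then show ?case
    by (auto intro!: continuous_at_imp_continuous_on differentiable_imp_continuous_within)
next
  case (Suc k)
  then show ?case by (metis C_k_on.simps(2))
qed

lemma C_k_on_le: "C_k_on k S f \<Longrightarrow> j \<le> k \<Longrightarrow> C_k_on j S f"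
  by (induction k) (auto simp: le_Suc_eq dest: C_k_on_Suc_imp simp del: C_k_on.simps(2))

text \<open>Uniqueness of the derivative identifies \<open>f'\<close> with the chosen
  \<open>frechet_derivative\<close>, so the closure rules below can work with explicit derivative
  formulas.\<close>

lemma C_k_on_SucI:
  assumes "open S" "\<And>x. x \<in> S \<Longrightarrow> (f has_derivative f' x) (at x)"
    and "\<And>v. C_k_on k S (\<lambda>x. f' x v)"
  shows "C_k_on (Suc k) S f"
proof -
  have "C_k_on k S (\<lambda>x. frechet_derivative f (at x) v)" for v
    using frechet_derivative_at[OF assms(2)] by (intro C_k_on_cong[OF assms(1) _ assms(3)]) auto
  then show ?thesis using assms(2) by (auto simp: differentiable_def)
qed

lemma C_k_on_has_derivative:
  "C_k_on (Suc k) S f \<Longrightarrow> x \<in> S \<Longrightarrow> (f has_derivative frechet_derivative f (at x)) (at x)"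
  by (auto simp: frechet_derivative_works[symmetric])

lemma C_k_on_const: "C_k_on k S (\<lambda>x. c)"
  by (induction k arbitrary: c) auto

lemma C_k_on_bounded_linear:
  assumes "bounded_linear f" "open S"
  shows "C_k_on k S f"
proof (cases k)
  case (Suc m)
  show ?thesis unfolding Suc
    by (rule C_k_on_SucI[OF assms(2), of _ "\<lambda>x. f"])
      (auto intro: C_k_on_const bounded_linear_imp_has_derivative assms)
qed (auto intro: linear_continuous_on assms)

lemma C_k_on_add:
  assumes "open S" "C_k_on k S f" "C_k_on k S g"
  shows "C_k_on k S (\<lambda>x. f x + g x)"
  using assms(2,3)
proof (induction k arbitrary: f g)
  case (Suc k)
  show ?case
    by (rule C_k_on_SucI[OF assms(1) has_derivative_add
          [OF C_k_on_has_derivative[OF Suc.prems(1)] C_k_on_has_derivative[OF Suc.prems(2)]]])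
      (use Suc.prems in \<open>auto intro!: Suc.IH\<close>)
qed (auto intro: continuous_intros)

lemma C_k_on_bounded_linear_comp:
  assumes "bounded_linear h" "open S" "C_k_on k S f"
  shows "C_k_on k S (\<lambda>x. h (f x))"
  using assms(3)
proof (induction k arbitrary: f)
  case 0
  then show ?case by (auto intro: bounded_linear.continuous_on assms)
next
  case (Suc k)
  show ?case
    by (rule C_k_on_SucI[OF assms(2) bounded_linear.has_derivative[OF assms(1)]],
        rule C_k_on_has_derivative[OF Suc.prems], assumption)
      (use Suc.prems in \<open>auto intro!: Suc.IH\<close>)
qed

lemma C_k_on_mult:
  fixes f g :: "'a::euclidean_space \<Rightarrow> real"
  assumes "open S" "C_k_on k S f" "C_k_on k S g"
  shows "C_k_on k S (\<lambda>x. f x * g x)"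
  using assms(2,3)
proof (induction k arbitrary: f g)
  case (Suc k)
  show ?case
  proof (rule C_k_on_SucI[OF assms(1) has_derivative_mult
          [OF C_k_on_has_derivative[OF Suc.prems(1)] C_k_on_has_derivative[OF Suc.prems(2)]]])
    fix v
    show "C_k_on k S (\<lambda>x. f x * frechet_derivative g (at x) v + frechet_derivative f (at x) v * g x)"
      by (intro C_k_on_add Suc.IH C_k_on_Suc_imp[OF Suc.prems(1)] C_k_on_Suc_imp[OF Suc.prems(2)] assms(1))
        (use Suc.prems in simp_all)
  qed
qed (auto intro: continuous_intros)

lemma C_k_on_sum:
  assumes "open S" "finite I" "\<And>i. i \<in> I \<Longrightarrow> C_k_on k S (f i)"
  shows "C_k_on k S (\<lambda>x. \<Sum>i\<in>I. f i x)"
  using assms(2,3) by (induction I) (auto intro!: C_k_on_add assms(1) C_k_on_const)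

text \<open>Differentiability is pointwise and continuity glues over open sets. This serves
  extension by zero and the treatment of powers of the norm near the origin.\<close>

lemma C_k_on_Un:
  assumes "open S" "open T" "C_k_on k S f" "C_k_on k T f"
  shows "C_k_on k (S \<union> T) f"
  using assms(3,4) by (induction k arbitrary: f) (auto intro: continuous_on_open_Un assms)

text \<open>The exponent is generalised in the induction because each differentiation replaces
  \<open>a\<close> by \<open>a - 1\<close>.\<close>

lemma C_k_on_powr:
  fixes g :: "'a::euclidean_space \<Rightarrow> real"
  assumes "open S" "\<And>x. x \<in> S \<Longrightarrow> g x > 0" "C_k_on k S g"
  shows "C_k_on k S (\<lambda>x. g x powr a)"
  using assms(3)
proof (induction k arbitrary: a)
  case 0
  then show ?case using assms(2) by (force intro!: continuous_on_powr continuous_intros)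
next
  case (Suc k)
  show ?case
  proof (rule C_k_on_SucI[OF assms(1)])
    fix x assume x: "x \<in> S"
    show "((\<lambda>x. g x powr a) has_derivative
       (\<lambda>v. a * g x powr (a - 1) * frechet_derivative g (at x) v)) (at x)"
      using C_k_on_has_derivative[OF Suc.prems x] assms(2)[OF x]
      by (auto intro!: derivative_eq_intros simp: powr_diff field_simps)
  next
    fix v
    show "C_k_on k S (\<lambda>x. a * g x powr (a - 1) * frechet_derivative g (at x) v)"
      by (intro C_k_on_mult C_k_on_const Suc.IH C_k_on_Suc_imp[OF Suc.prems] assms(1))
        (use Suc.prems in simp)
  qed
qed

lemma has_real_derivative_max_0_power:
  "((\<lambda>t. max 0 t ^ Suc (Suc m)) has_real_derivative real (Suc (Suc m)) * max 0 t ^ Suc m) (at t)"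
proof -
  consider "t > 0" | "t < 0" | "t = 0" by linarith
  then show ?thesis
  proof cases
    case 1
    have "((\<lambda>t. t ^ Suc (Suc m)) has_real_derivative real (Suc (Suc m)) * max 0 t ^ Suc m) (at t)"
      using 1 by (auto intro!: derivative_eq_intros simp del: power_Suc)
    then show ?thesis
      by (rule has_field_derivative_transform_within_open[of _ _ _ "{0<..}"]) (use 1 in auto)
  next
    case 2
    have "((\<lambda>t. 0) has_real_derivative real (Suc (Suc m)) * max 0 t ^ Suc m) (at t)"
      using 2 by (auto intro!: derivative_eq_intros)
    then show ?thesis
      by (rule has_field_derivative_transform_within_open[of _ _ _ "{..<0}"]) (use 2 in auto)
  next
    case 3
    \<comment> \<open>At 0 the difference quotient is at most \<open>\<bar>h\<bar> ^ Suc m\<close>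
      in absolute value, and this tends to 0 because the exponent is positive.\<close>
    have "((\<lambda>h::real. \<bar>h\<bar> ^ Suc m) \<longlongrightarrow> \<bar>0\<bar> ^ Suc m) (at 0)" by (intro tendsto_intros)
    then have "((\<lambda>h::real. \<bar>h\<bar> ^ Suc m) \<longlongrightarrow> 0) (at 0)" by simp
    moreover have "norm (max 0 h ^ Suc (Suc m) / h) \<le> \<bar>h\<bar> ^ Suc m" for h :: real
    proof (cases "h > 0")
      case False
      then have "max 0 h = 0" by simp
      then show ?thesis using zero_le_power[of "\<bar>h\<bar>" "Suc m"] by (simp del: power_Suc)
    qed simp
    ultimately have "((\<lambda>h::real. max 0 h ^ Suc (Suc m) / h) \<longlongrightarrow> 0) (at 0)"
      by (auto intro: Lim_null_comparison[of _ "\<lambda>h. \<bar>h\<bar> ^ Suc m"])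
    then show ?thesis using 3 by (simp add: DERIV_def)
  qed
qed

text \<open>A truncated power loses one exponent per derivative, so the exponent
  \<open>Suc k\<close> leaves a continuous function after \<open>k\<close> of them. With
  \<open>g\<close> quadratic this gives an explicit compactly supported radial cutoff.\<close>

lemma C_k_on_max_0_power:
  fixes g :: "'a::euclidean_space \<Rightarrow> real"
  assumes "open S" "C_k_on k S g"
  shows "C_k_on k S (\<lambda>x. max 0 (g x) ^ Suc k)"
  using assms(2)
proof (induction k)
  case 0
  then show ?case by (auto intro!: continuous_intros)
next
  case (Suc k)
  show ?case
  proof (rule C_k_on_SucI[OF assms(1)])
    fix x assume x: "x \<in> S"
    show "((\<lambda>x. max 0 (g x) ^ Suc (Suc k)) has_derivative
       (\<lambda>v. frechet_derivative g (at x) v * (real (Suc (Suc k)) * max 0 (g x) ^ Suc k))) (at x)"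
      by (rule DERIV_compose_FDERIV[OF has_real_derivative_max_0_power C_k_on_has_derivative[OF Suc.prems x]])
  next
    fix v
    show "C_k_on k S (\<lambda>x. frechet_derivative g (at x) v * (real (Suc (Suc k)) * max 0 (g x) ^ Suc k))"
      by (intro C_k_on_mult C_k_on_const Suc.IH C_k_on_Suc_imp[OF Suc.prems] assms(1))
        (use Suc.prems in simp)
  qed
qed

section \<open>Symmetry of second derivatives\<close>

lemma mixed_difference_eq:
  fixes f :: "'a::euclidean_space \<Rightarrow> real"
  assumes f: "C_k_on 2 UNIV f" and "h > 0"
  defines "F \<equiv> (\<lambda>v x. frechet_derivative f (at x) v)"
  obtains a b where "0 < a" "a < h" "0 < b" "b < h"
    "f (x + h *\<^sub>R v + h *\<^sub>R w) - f (x + h *\<^sub>R v) - f (x + h *\<^sub>R w) + f x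
      = h * h * frechet_derivative (F v) (at (x + a *\<^sub>R v + b *\<^sub>R w)) w"
proof -
  have 1: "(f has_derivative (\<lambda>v. F v x)) (at x)" for x
    using f C_k_on_has_derivative[of 1 UNIV f x] by (simp add: numeral_2_eq_2 F_def)
  have 2: "(F v has_derivative frechet_derivative (F v) (at x)) (at x)" for x
    using f C_k_on_has_derivative[of 0 UNIV "F v" x] by (auto simp: numeral_2_eq_2 F_def)
  \<comment> \<open>The second difference is the increment of \<open>p\<close> over an interval of
    length \<open>h\<close>. The mean value theorem is applied to \<open>p\<close> along
    \<open>v\<close>, then to \<open>F v\<close> along \<open>w\<close>.\<close>
  define p where "p t = f (x + t *\<^sub>R v + h *\<^sub>R w) - f (x + t *\<^sub>R v)" for t
  have line: "((\<lambda>t. f (y + t *\<^sub>R v)) has_real_derivative F v (y + t *\<^sub>R v)) (at t)" for y t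
  proof -
    have a: "((\<lambda>t. y + t *\<^sub>R v) has_derivative (\<lambda>s. s *\<^sub>R v)) (at t)"
      by (auto intro!: derivative_eq_intros)
    have b: "F (s *\<^sub>R v) x = s * F v x" for s x
      using linear_cmul[OF has_derivative_linear[OF 1[of x]], of s v] by simp
    show ?thesis
      using has_derivative_compose[OF a 1]
      by (simp only: b has_field_derivative_def mult_commute_abs)
  qed
  have "x + h *\<^sub>R w + t *\<^sub>R v = x + t *\<^sub>R v + h *\<^sub>R w" for t
    by (simp only: add_ac)
  then have "(p has_real_derivative F v (x + t *\<^sub>R v + h *\<^sub>R w) - F v (x + t *\<^sub>R v)) (at t)" for t
    using DERIV_diff[OF line[of "x + h *\<^sub>R w" t] line[of x t]] by (simp only: p_def[abs_def])
  from MVT2[OF \<open>h > 0\<close>, of p, OF this] obtain a where a: "0 < a" "a < h"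
    "p h - p 0 = h * (F v (x + a *\<^sub>R v + h *\<^sub>R w) - F v (x + a *\<^sub>R v))" by auto
  have line2: "((\<lambda>t. F v (y + t *\<^sub>R w)) has_real_derivative
      frechet_derivative (F v) (at (y + t *\<^sub>R w)) w) (at t)" for y t
  proof -
    have a: "((\<lambda>t. y + t *\<^sub>R w) has_derivative (\<lambda>s. s *\<^sub>R w)) (at t)"
      by (auto intro!: derivative_eq_intros)
    have b: "frechet_derivative (F v) (at x) (s *\<^sub>R w) = s * frechet_derivative (F v) (at x) w" for s x
      using linear_cmul[OF has_derivative_linear[OF 2[of x]], of s w] by simp
    show ?thesis
      using has_derivative_compose[OF a 2]
      by (simp only: b has_field_derivative_def mult_commute_abs)
  qed
  from MVT2[OF \<open>h > 0\<close>, of "\<lambda>t. F v (x + a *\<^sub>R v + t *\<^sub>R w)", OF line2] obtain b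
    where b: "0 < b" "b < h" "F v (x + a *\<^sub>R v + h *\<^sub>R w) - F v (x + a *\<^sub>R v)
      = h * frechet_derivative (F v) (at (x + a *\<^sub>R v + b *\<^sub>R w)) w" by auto
  have "p h - p 0 = h * h * frechet_derivative (F v) (at (x + a *\<^sub>R v + b *\<^sub>R w)) w"
    unfolding a(3) b(3) by simp
  then show ?thesis using that[OF a(1,2) b(1,2)] by (simp add: p_def)
qed

text \<open>The second difference is symmetric in \<open>v\<close> and \<open>w\<close>, so every
  \<open>h > 0\<close> yields two points within distance of order \<open>h\<close> of
  \<open>x\<close> at which the two mixed derivatives agree. Letting \<open>h\<close> tend to 0,
  continuity gives equality at \<open>x\<close>.\<close>

lemma frechet_derivative_commute:
  fixes f :: "'a::euclidean_space \<Rightarrow> real"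
  assumes f: "C_k_on 2 UNIV f"
  shows "frechet_derivative (\<lambda>x. frechet_derivative f (at x) v) (at x) w
       = frechet_derivative (\<lambda>x. frechet_derivative f (at x) w) (at x) v"
proof -
  define H where "H v w x = frechet_derivative (\<lambda>x. frechet_derivative f (at x) v) (at x) w" for v w x
  define C where "C = norm v + norm w"
  have F: "\<exists>y z. norm (y - x) \<le> h * C \<and> norm (z - x) \<le> h * C \<and> H v w y = H w v z"
    if h: "h > 0" for h :: real
  proof -
    obtain a b where 1: "0 < a" "a < h" "0 < b" "b < h"
     "f (x + h *\<^sub>R v + h *\<^sub>R w) - f (x + h *\<^sub>R v) - f (x + h *\<^sub>R w) + f x
      = h * h * H v w (x + a *\<^sub>R v + b *\<^sub>R w)"
      unfolding H_def by (rule mixed_difference_eq[OF f h])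
    obtain c d where 2: "0 < c" "c < h" "0 < d" "d < h"
     "f (x + h *\<^sub>R w + h *\<^sub>R v) - f (x + h *\<^sub>R w) - f (x + h *\<^sub>R v) + f x
      = h * h * H w v (x + c *\<^sub>R w + d *\<^sub>R v)"
      unfolding H_def by (rule mixed_difference_eq[OF f h])
    have "x + h *\<^sub>R w + h *\<^sub>R v = x + h *\<^sub>R v + h *\<^sub>R w"
      by (simp only: add_ac)
    then have "h * h * H v w (x + a *\<^sub>R v + b *\<^sub>R w) = h * h * H w v (x + c *\<^sub>R w + d *\<^sub>R v)"
      unfolding 1(5)[symmetric] 2(5)[symmetric] by (simp only: diff_right_commute)
    then have "H v w (x + a *\<^sub>R v + b *\<^sub>R w) = H w v (x + c *\<^sub>R w + d *\<^sub>R v)"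
      using h by simp
    moreover have "norm (x + r *\<^sub>R v + s *\<^sub>R w - x) \<le> h * C" "norm (x + r *\<^sub>R w + s *\<^sub>R v - x) \<le> h * C"
      if "0 < r" "r < h" "0 < s" "s < h" for r s
    proof -
      have "r * norm v + s * norm w \<le> h * C" "r * norm w + s * norm v \<le> h * C"
        using that mult_right_mono[of r h "norm v"] mult_right_mono[of s h "norm w"]
          mult_right_mono[of r h "norm w"] mult_right_mono[of s h "norm v"]
        by (auto simp: C_def distrib_left)
      then show "norm (x + r *\<^sub>R v + s *\<^sub>R w - x) \<le> h * C" "norm (x + r *\<^sub>R w + s *\<^sub>R v - x) \<le> h * C"
        using norm_triangle_ineq[of "r *\<^sub>R v" "s *\<^sub>R w"] norm_triangle_ineq[of "r *\<^sub>R w" "s *\<^sub>R v"] that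
        by (auto simp: add.assoc)
    qed
    ultimately show ?thesis using 1(1-4) 2(1-4) by metis
  qed
  have "\<exists>y z. norm (y - x) \<le> inverse (real (Suc n)) * C \<and> norm (z - x) \<le> inverse (real (Suc n)) * C
      \<and> H v w y = H w v z" for n
    by (rule F) simp
  then obtain y z where yz: "\<And>n. norm (y n - x) \<le> inverse (real (Suc n)) * C"
      "\<And>n. norm (z n - x) \<le> inverse (real (Suc n)) * C" "\<And>n. H v w (y n) = H w v (z n)"
    by metis
  have lim: "e \<longlonglongrightarrow> x" if "\<And>n. norm (e n - x) \<le> inverse (real (Suc n)) * C" for e
    by (rule LIM_zero_cancel, rule Lim_null_comparison[OF always_eventually])
      (use that tendsto_mult_right[OF LIMSEQ_inverse_real_of_nat, of C] in auto)
  have cont: "continuous_on UNIV (H v w)" for v w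
    using f by (auto simp: numeral_2_eq_2 H_def)
  have "(\<lambda>n. H v w (y n)) \<longlonglongrightarrow> H v w x"
    using continuous_on_tendsto_compose[OF cont lim[OF yz(1)]] by simp
  moreover have "(\<lambda>n. H w v (z n)) \<longlonglongrightarrow> H w v x"
    using continuous_on_tendsto_compose[OF cont lim[OF yz(2)]] by simp
  ultimately have "H v w x = H w v x"
    unfolding yz(3) by (rule LIMSEQ_unique)
  then show ?thesis by (simp add: H_def)
qed

section \<open>Partial derivatives and integration by parts\<close>

text \<open>The real-valued counterpart of \<open>partial_deriv\<close>; complex functions will
  enter only through their real and imaginary parts.\<close>

definition partial :: "'n \<Rightarrow> (real^'n \<Rightarrow> real) \<Rightarrow> real^'n \<Rightarrow> real" where
  "partial i f x = frechet_derivative f (at x) (axis i 1)"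

lemma partial_eqI: "(f has_derivative f') (at x) \<Longrightarrow> partial i f x = f' (axis i 1)"
  using frechet_derivative_at unfolding partial_def by metis

lemma C_1_has_derivative:
  "C_k_on 1 UNIV f \<Longrightarrow> (f has_derivative frechet_derivative f (at x)) (at x)"
  using C_k_on_has_derivative[of 0 UNIV f x] by simp

lemma partial_const [simp]: "partial i (\<lambda>x. c) = (\<lambda>x. 0)"
  by (simp add: partial_def fun_eq_iff)

lemma partial_bounded_linear: "bounded_linear f \<Longrightarrow> partial i f = (\<lambda>x. f (axis i 1))"
  by (auto simp: fun_eq_iff intro!: partial_eqI bounded_linear_imp_has_derivative)

lemma partial_nth: "partial i (\<lambda>x. x $ j) = (\<lambda>x. if i = j then 1 else 0)"
  by (subst partial_bounded_linear) (auto simp: bounded_linear_vec_nth axis_def)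

lemma partial_add:
  assumes "C_k_on 1 UNIV f" "C_k_on 1 UNIV g"
  shows "partial i (\<lambda>x. f x + g x) = (\<lambda>x. partial i f x + partial i g x)"
proof
  fix x
  show "partial i (\<lambda>x. f x + g x) x = partial i f x + partial i g x"
    unfolding partial_eqI[OF has_derivative_add[OF C_1_has_derivative[OF assms(1)] C_1_has_derivative[OF assms(2)]]]
    by (simp add: partial_def)
qed

lemma partial_mult:
  assumes "C_k_on 1 UNIV f" "C_k_on 1 UNIV g"
  shows "partial i (\<lambda>x. f x * g x) = (\<lambda>x. f x * partial i g x + partial i f x * g x)"
proof
  fix x
  show "partial i (\<lambda>x. f x * g x) x = f x * partial i g x + partial i f x * g x"
    unfolding partial_eqI[OF has_derivative_mult[OF C_1_has_derivative[OF assms(1)] C_1_has_derivative[OF assms(2)]]]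
    by (simp add: partial_def)
qed

lemma partial_cmult:
  assumes "C_k_on 1 UNIV f"
  shows "partial i (\<lambda>x. c * f x) = (\<lambda>x. c * partial i f x)"
  using partial_mult[OF C_k_on_const assms] by simp

lemma partial_sum:
  assumes "finite I" "\<And>j. j \<in> I \<Longrightarrow> C_k_on 1 UNIV (f j)"
  shows "partial i (\<lambda>x. \<Sum>j\<in>I. f j x) = (\<lambda>x. \<Sum>j\<in>I. partial i (f j) x)"
  using assms
  by (induction I) (auto simp: partial_add C_k_on_sum simp del: C_k_on.simps)

lemma C_k_on_partial: "C_k_on (Suc k) UNIV f \<Longrightarrow> C_k_on k UNIV (partial i f)"
  by (simp add: partial_def[abs_def])

lemma partial_commute:
  "C_k_on 2 UNIV f \<Longrightarrow> partial i (partial j f) = partial j (partial i f)"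
  unfolding partial_def[abs_def] by (intro ext frechet_derivative_commute)

lemma C_k_on_nth: "C_k_on k UNIV (\<lambda>x::real^'n. x $ i)"
  by (intro C_k_on_bounded_linear bounded_linear_vec_nth open_UNIV)

lemmas C_k_intros = C_k_on_add C_k_on_mult C_k_on_sum C_k_on_const C_k_on_nth C_k_on_partial open_UNIV

section \<open>Bounded support and the vanishing of the integral of a derivative\<close>

definition bounded_support :: "(real^'n \<Rightarrow> real) \<Rightarrow> bool" where
  "bounded_support f \<longleftrightarrow> (\<exists>B. \<forall>x. f x \<noteq> 0 \<longrightarrow> norm x \<le> B)"

lemma bounded_support_mult:
  "bounded_support f \<Longrightarrow> bounded_support (\<lambda>x. f x * g x)"
  "bounded_support f \<Longrightarrow> bounded_support (\<lambda>x. g x * f x)"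
  by (auto simp: bounded_support_def)

lemma bounded_support_add:
  assumes "bounded_support f" "bounded_support g"
  shows "bounded_support (\<lambda>x. f x + g x)"
proof -
  obtain A B where "\<And>x. f x \<noteq> 0 \<Longrightarrow> norm x \<le> A" "\<And>x. g x \<noteq> 0 \<Longrightarrow> norm x \<le> B"
    using assms by (auto simp: bounded_support_def)
  then have "norm x \<le> max A B" if "f x + g x \<noteq> 0" for x
    using that by (cases "f x = 0") (force simp: le_max_iff_disj)+
  then show ?thesis by (auto simp: bounded_support_def)
qed

lemma bounded_support_0 [simp]: "bounded_support (\<lambda>x. 0)"
  by (auto simp: bounded_support_def)

lemma bounded_support_sum:
  "finite I \<Longrightarrow> (\<And>i. i \<in> I \<Longrightarrow> bounded_support (f i)) \<Longrightarrow> bounded_support (\<lambda>x. \<Sum>i\<in>I. f i x)"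
  by (induction I rule: finite_induct) (auto intro: bounded_support_add)

lemma partial_eq_0_of_open:
  assumes "open S" "x \<in> S" "\<And>y. y \<in> S \<Longrightarrow> f y = 0"
  shows "partial i f x = 0"
proof -
  have "(f has_derivative (\<lambda>h. 0)) (at x)"
    by (rule has_derivative_transform_within_open[of "\<lambda>x. 0" _ _ UNIV S]) (use assms in auto)
  then show ?thesis by (rule partial_eqI)
qed

lemma partial_eq_0_of_bound:
  assumes "\<And>x. f x \<noteq> 0 \<Longrightarrow> norm x \<le> B" "norm x > B"
  shows "partial i f x = 0"
  by (rule partial_eq_0_of_open[of "{x. norm x > B}"])
    (use assms in \<open>force intro!: open_Collect_less continuous_intros\<close>)+

lemma bounded_support_partial: "bounded_support f \<Longrightarrow> bounded_support (partial i f)"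
  unfolding bounded_support_def by (meson partial_eq_0_of_bound not_le_imp_less)

lemma integrable_bounded_support:
  assumes "continuous_on UNIV f" "bounded_support f"
  shows "integrable lborel f"
proof -
  obtain B where B: "\<And>x. f x \<noteq> 0 \<Longrightarrow> norm x \<le> B"
    using assms by (auto simp: bounded_support_def)
  have "integrable lborel (\<lambda>x. indicator (cball 0 B) x *\<^sub>R f x)"
    by (rule borel_integrable_compact) (auto intro: continuous_on_subset[OF assms(1)])
  also have "(\<lambda>x. indicator (cball 0 B) x *\<^sub>R f x) = f"
    using B by (force simp: indicator_def fun_eq_iff)
  finally show ?thesis .
qed

lemma C_k_on_continuous: "C_k_on k S f \<Longrightarrow> continuous_on S f"
  using C_k_on_le[of k S f 0] by simp

lemma has_real_derivative_line:
  assumes "C_k_on 1 UNIV f"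
  shows "((\<lambda>t. f (x + t *\<^sub>R axis i 1)) has_real_derivative partial i f (x + t *\<^sub>R axis i 1)) (at t)"
proof -
  have a: "((\<lambda>t. x + t *\<^sub>R axis i (1::real)) has_derivative (\<lambda>s. s *\<^sub>R axis i 1)) (at t)"
    by (auto intro!: derivative_eq_intros)
  note d = C_1_has_derivative[OF assms]
  have b: "frechet_derivative f (at y) (s *\<^sub>R axis i 1) = s * partial i f y" for s y
    using linear_cmul[OF has_derivative_linear[OF d[of y]], of s "axis i 1"] by (simp add: partial_def)
  show ?thesis
    using has_derivative_compose[OF a d]
    by (simp only: b has_field_derivative_def mult_commute_abs)
qed

text \<open>Difference quotients integrate to zero by translation invariance of Lebesgue measure,
  and they converge dominatedly to the partial derivative.\<close>

lemma integral_partial_eq_0: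
  fixes f :: "real^'n \<Rightarrow> real"
  assumes f: "C_k_on 1 UNIV f" and "bounded_support f"
  shows "(LINT x|lborel. partial i f x) = 0"
proof -
  obtain B where B: "\<And>x. f x \<noteq> 0 \<Longrightarrow> norm x \<le> B"
    using assms by (auto simp: bounded_support_def)
  let ?e = "axis i 1 :: real^'n"
  have cf: "continuous_on UNIV f" by (rule C_k_on_continuous[OF f])
  have cp: "continuous_on UNIV (partial i f)"
    using C_k_on_partial[of 0 f] f by simp
  have "bounded (partial i f ` cball 0 B)"
    by (intro compact_imp_bounded compact_continuous_image continuous_on_subset[OF cp]) auto
  then obtain K0 where K0: "\<And>x. norm x \<le> B \<Longrightarrow> \<bar>partial i f x\<bar> \<le> K0"
    by (force simp: bounded_iff)
  \<comment> \<open>The maximum with 0 makes the bound valid outside the ball as well, where the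
    derivative is zero, and when the ball is empty.\<close>
  define K where "K = max K0 0"
  have K: "\<bar>partial i f x\<bar> \<le> K" for x
    using K0[of x] partial_eq_0_of_bound[OF B, where x=x]
    by (cases "norm x \<le> B") (auto simp: K_def)
  define g where "g n x = (f (x + inverse (real (Suc n)) *\<^sub>R ?e) - f x) * real (Suc n)" for n x
  \<comment> \<open>By the mean value theorem a quotient with step at most 1 is a derivative at a
    point within distance 1. All quotients are therefore bounded by \<open>K\<close> and vanish
    outside the ball of radius \<open>B + 1\<close>.\<close>
  have gK: "\<exists>y. norm (y - x) \<le> 1 \<and> g n x = partial i f y" for n x
  proof -
    let ?h = "inverse (real (Suc n))"
    obtain t where t: "0 < t" "t < ?h"
      "f (x + ?h *\<^sub>R ?e) - f (x + 0 *\<^sub>R ?e) = (?h - 0) * partial i f (x + t *\<^sub>R ?e)"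
      using MVT2[of 0 ?h, OF _ has_real_derivative_line[OF f]] by auto
    have "g n x = partial i f (x + t *\<^sub>R ?e)"
      using t(3) by (simp add: g_def)
    moreover have "?h \<le> 1" by (simp add: inverse_le_1_iff)
    ultimately show ?thesis using t by (intro exI[of _ "x + t *\<^sub>R ?e"]) auto
  qed
  have bound: "norm (g n x) \<le> K * indicator (cball 0 (B + 1)) x" for n x
  proof -
    obtain y where y: "norm (y - x) \<le> 1" "g n x = partial i f y" using gK by blast
    show ?thesis
    proof (cases "norm y \<le> B")
      case True
      then have "norm x \<le> B + 1" using y(1) norm_triangle_sub[of x y] by (simp add: norm_minus_commute)
      then show ?thesis using K[of y] y(2) by simp
    next
      case False
      then show ?thesis using y(2) partial_eq_0_of_bound[OF B, where x=y] K[of x] by simp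
    qed
  qed
  have lim: "(\<lambda>n. g n x) \<longlonglongrightarrow> partial i f x" for x
  proof -
    have d: "((\<lambda>t. f (x + t *\<^sub>R ?e)) has_real_derivative partial i f x) (at 0)"
      using has_real_derivative_line[OF f, of x i 0] by simp
    have "filterlim (\<lambda>n. inverse (real (Suc n))) (at 0) sequentially"
      by (rule filterlim_atI[OF LIMSEQ_inverse_real_of_nat]) auto
    from filterlim_compose[OF d[unfolded DERIV_def] this] show ?thesis
      by (simp add: g_def field_simps)
  qed
  have mg: "g n \<in> borel_measurable borel" for n
    unfolding g_def[abs_def]
    by (intro borel_measurable_continuous_onI continuous_intros continuous_on_compose2[OF cf]) auto
  have "(\<lambda>n. LINT x|lborel. g n x) \<longlonglongrightarrow> (LINT x|lborel. partial i f x)"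
  proof (rule integral_dominated_convergence[where w = "\<lambda>x. K * indicator (cball 0 (B + 1)) x"])
    show "integrable lborel (\<lambda>x::real^'n. K * indicator (cball 0 (B + 1)) x :: real)"
      using emeasure_lborel_cball_finite[of "0::real^'n" "B + 1"]
      by (intro integrable_mult_right integrable_real_indicator) (auto simp: infinity_ennreal_def)
    show "partial i f \<in> borel_measurable lborel"
      using borel_measurable_continuous_onI[OF cp] by simp
  qed (use lim bound mg in auto)
  moreover have "(LINT x|lborel. g n x) = 0" for n
  proof -
    let ?c = "inverse (real (Suc n)) *\<^sub>R ?e"
    have mf: "f \<in> borel_measurable borel" using borel_measurable_continuous_onI[OF cf] .
    have i0: "integrable lborel f" by (rule integrable_bounded_support[OF cf assms(2)])
    have "integrable (distr lborel borel ((+) ?c)) f" "integral\<^sup>L (distr lborel borel ((+) ?c)) f = (LINT x|lborel. f x)"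
      using i0 by (simp_all only: lborel_distr_plus)
    then have i1: "integrable lborel (\<lambda>x. f (x + ?c))" "(LINT x|lborel. f (x + ?c)) = (LINT x|lborel. f x)"
      using mf by (simp_all add: integrable_distr_eq integral_distr add.commute)
    show ?thesis
      unfolding g_def using i0 i1 by simp
  qed
  ultimately show ?thesis using LIMSEQ_unique[OF tendsto_const] by force
qed

section \<open>Rotations, the Euler operator and the spherical Laplacian\<close>

text \<open>The infinitesimal rotation in the plane of the coordinates \<open>i\<close> and
  \<open>k\<close>. It is tangent to spheres, so it annihilates radial functions, and its polynomial
  coefficients make it regular at the origin.\<close>

definition rot :: "'n \<Rightarrow> 'n \<Rightarrow> (real^'n \<Rightarrow> real) \<Rightarrow> real^'n \<Rightarrow> real" where
  "rot i k f x = x $ i * partial k f x - x $ k * partial i f x"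

definition euler :: "(real^'n \<Rightarrow> real) \<Rightarrow> real^'n \<Rightarrow> real" where
  "euler f x = (\<Sum>i\<in>UNIV. x $ i * partial i f x)"

text \<open>Minus the Laplace--Beltrami operator in the angular variables.\<close>

definition sph :: "(real^'n \<Rightarrow> real) \<Rightarrow> real^'n \<Rightarrow> real" where
  "sph f x = - (\<Sum>i\<in>UNIV. \<Sum>k\<in>UNIV. rot i k (rot i k f) x) / 2"

lemma C_k_on_rot: "C_k_on (Suc k) UNIV f \<Longrightarrow> C_k_on k UNIV (rot i j f)"
proof -
  assume f: "C_k_on (Suc k) UNIV f"
  have "C_k_on k UNIV (\<lambda>x. x $ i * partial j f x + (-1) * (x $ j * partial i f x))"
    by (intro C_k_intros f)
  then show ?thesis by (simp add: rot_def[abs_def])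
qed

lemma C_k_on_euler: "C_k_on (Suc k) UNIV f \<Longrightarrow> C_k_on k UNIV (euler f)"
  unfolding euler_def[abs_def] by (intro C_k_intros) auto

lemma C_k_on_sph:
  assumes "C_k_on (Suc (Suc k)) UNIV f"
  shows "C_k_on k UNIV (sph f)"
proof -
  have "C_k_on k UNIV (\<lambda>x. (- 1/2) * (\<Sum>i\<in>UNIV. \<Sum>j\<in>UNIV. rot i j (rot i j f) x))"
    by (intro C_k_intros C_k_on_rot assms) auto
  then show ?thesis by (simp add: sph_def[abs_def])
qed

lemma C_k_on_1_of_2: "C_k_on 2 S f \<Longrightarrow> C_k_on 1 S f"
  by (erule C_k_on_le) simp

lemma C_1_of_C_2:
  assumes "C_k_on 2 UNIV f"
  shows "C_k_on 1 UNIV (partial i f)" "C_k_on 1 UNIV (rot i k f)" "C_k_on 1 UNIV (euler f)"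
    "continuous_on UNIV (sph f)"
proof -
  have 2: "2 = Suc 1" "2 = Suc (Suc 0)" by simp_all
  show "C_k_on 1 UNIV (partial i f)" "C_k_on 1 UNIV (rot i k f)" "C_k_on 1 UNIV (euler f)"
    using assms unfolding 2(1) by (rule C_k_on_partial C_k_on_rot C_k_on_euler)+
  show "continuous_on UNIV (sph f)"
    using assms unfolding 2(2) by (rule C_k_on_continuous[OF C_k_on_sph])
qed

lemma continuous_of_C_1:
  assumes "C_k_on 1 UNIV f"
  shows "continuous_on UNIV f" "continuous_on UNIV (partial i f)" "continuous_on UNIV (rot i k f)"
    "continuous_on UNIV (euler f)"
proof -
  show "continuous_on UNIV f" using assms by (rule C_k_on_continuous)
  show "continuous_on UNIV (partial i f)" "continuous_on UNIV (rot i k f)" "continuous_on UNIV (euler f)"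
    using assms unfolding One_nat_def by (rule C_k_on_continuous[OF C_k_on_partial]
      C_k_on_continuous[OF C_k_on_rot] C_k_on_continuous[OF C_k_on_euler])+
qed

lemma bounded_support_rot:
  assumes "bounded_support f"
  shows "bounded_support (rot i k f)"
  using bounded_support_add[OF bounded_support_mult(2)[OF bounded_support_partial[OF assms], of "\<lambda>x. x $ i"]
     bounded_support_mult(2)[OF bounded_support_partial[OF assms], of "\<lambda>x. - x $ k"]]
  by (simp add: rot_def[abs_def])

lemma bounded_support_euler: "bounded_support f \<Longrightarrow> bounded_support (euler f)"
  unfolding euler_def[abs_def]
  by (intro bounded_support_sum bounded_support_mult bounded_support_partial) auto

lemma bounded_support_sph: "bounded_support f \<Longrightarrow> bounded_support (sph f)"
  unfolding sph_def[abs_def] minus_divide_left[symmetric] divide_inverse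
  using bounded_support_mult(2)[of "\<lambda>x. \<Sum>i\<in>UNIV. \<Sum>k\<in>UNIV. rot i k (rot i k f) x" "\<lambda>x. - inverse 2"]
  by (simp add: bounded_support_sum bounded_support_rot mult.commute)

lemma rot_mult:
  assumes "C_k_on 1 UNIV f" "C_k_on 1 UNIV g"
  shows "rot i k (\<lambda>x. f x * g x) = (\<lambda>x. f x * rot i k g x + rot i k f x * g x)"
  by (simp add: rot_def fun_eq_iff partial_mult[OF assms] algebra_simps)

lemma rot_add:
  assumes "C_k_on 1 UNIV f" "C_k_on 1 UNIV g"
  shows "rot i k (\<lambda>x. f x + g x) = (\<lambda>x. rot i k f x + rot i k g x)"
  by (simp add: rot_def fun_eq_iff partial_add[OF assms] algebra_simps)

lemma rot_cmult:
  assumes "C_k_on 1 UNIV f"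
  shows "rot i k (\<lambda>x. c * f x) = (\<lambda>x. c * rot i k f x)"
  by (simp add: rot_def fun_eq_iff partial_cmult[OF assms] algebra_simps)

lemma euler_mult:
  assumes "C_k_on 1 UNIV f" "C_k_on 1 UNIV g"
  shows "euler (\<lambda>x. f x * g x) = (\<lambda>x. f x * euler g x + euler f x * g x)"
  by (simp add: euler_def fun_eq_iff partial_mult[OF assms] distrib_left sum.distrib
      sum_distrib_left sum_distrib_right mult_ac)

lemma euler_add:
  assumes "C_k_on 1 UNIV f" "C_k_on 1 UNIV g"
  shows "euler (\<lambda>x. f x + g x) = (\<lambda>x. euler f x + euler g x)"
  by (simp add: euler_def fun_eq_iff partial_add[OF assms] distrib_left sum.distrib)

lemma euler_cmult:
  assumes "C_k_on 1 UNIV f"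
  shows "euler (\<lambda>x. c * f x) = (\<lambda>x. c * euler f x)"
  by (simp add: euler_def fun_eq_iff partial_cmult[OF assms] sum_distrib_left mult_ac)

lemma sph_add:
  assumes "C_k_on 2 UNIV f" "C_k_on 2 UNIV g"
  shows "sph (\<lambda>x. f x + g x) = (\<lambda>x. sph f x + sph g x)"
proof -
  note [simp del] = C_k_on.simps One_nat_def
  have *: "C_k_on 1 UNIV f" "C_k_on 1 UNIV g"
    using assms by (auto intro: C_k_on_le)
  note C_1_of_C_2(2)[OF assms(1)] C_1_of_C_2(2)[OF assms(2)]
  then show ?thesis using *
    by (simp add: sph_def fun_eq_iff rot_add sum.distrib add_divide_distrib)
qed

text \<open>By the Leibniz rule a function annihilated by all rotations behaves like a constant
  under \<open>sph\<close>.\<close>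

lemma sph_radial_mult:
  assumes "C_k_on 2 UNIV f" "C_k_on 2 UNIV h" and h: "\<And>i k. rot i k h = (\<lambda>x. 0)"
  shows "sph (\<lambda>x. h x * f x) = (\<lambda>x. h x * sph f x)"
proof -
  note [simp del] = C_k_on.simps One_nat_def
  have *: "C_k_on 1 UNIV f" "C_k_on 1 UNIV h"
    using assms by (auto intro: C_k_on_le)
  note C_1_of_C_2(2)[OF assms(1)]
  then show ?thesis using *
    by (simp add: sph_def fun_eq_iff rot_mult h sum_distrib_left)
qed

lemma sph_cmult:
  assumes "C_k_on 2 UNIV f"
  shows "sph (\<lambda>x. c * f x) = (\<lambda>x. c * sph f x)"
  by (rule sph_radial_mult[OF assms]) (auto simp: C_k_on_const rot_def simp del: C_k_on.simps)

lemma sph_sum: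
  assumes "finite I" "\<And>j. j \<in> I \<Longrightarrow> C_k_on 2 UNIV (f j)"
  shows "sph (\<lambda>x. \<Sum>j\<in>I. f j x) = (\<lambda>x. \<Sum>j\<in>I. sph (f j) x)"
  using assms
proof (induction I)
  case empty
  then show ?case using sph_cmult[OF C_k_on_const, of 0 0] by simp
next
  case (insert j I)
  then show ?case
    by (simp add: sph_add C_k_on_sum del: C_k_on.simps)
qed

section \<open>Integration by parts for \<open>rot\<close>, \<open>euler\<close> and
  \<open>sph\<close>\<close>

lemma integrable_mult_bounded_support:
  "continuous_on UNIV f \<Longrightarrow> continuous_on UNIV g \<Longrightarrow> bounded_support f \<Longrightarrow> integrable lborel (\<lambda>x. f x * g x)"
  by (intro integrable_bounded_support continuous_intros bounded_support_mult)

lemma partial_nth_mult: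
  assumes "C_k_on 1 UNIV f"
  shows "partial k (\<lambda>x. x $ i * f x) = (\<lambda>x. x $ i * partial k f x + (if k = i then f x else 0))"
  by (auto simp: partial_mult[OF C_k_on_nth assms] partial_nth fun_eq_iff)

text \<open>The rotation field is divergence free: \<open>rot i k f\<close> is the difference of the
  \<open>k\<close>-th partial derivative of \<open>x $ i * f x\<close> and the \<open>i\<close>-th
  partial derivative of \<open>x $ k * f x\<close>.\<close>

lemma integral_rot_eq_0:
  assumes "C_k_on 1 UNIV f" "bounded_support f"
  shows "(LINT x|lborel. rot i k f x) = 0"
proof -
  have eq: "rot i k f = (\<lambda>x. partial k (\<lambda>x. x $ i * f x) x - partial i (\<lambda>x. x $ k * f x) x)"
    by (auto simp: rot_def fun_eq_iff partial_nth_mult[OF assms(1)])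
  have C: "C_k_on 1 UNIV (\<lambda>x. x $ j * f x)" for j by (intro C_k_intros assms)
  have "integrable lborel (partial l (\<lambda>x. x $ j * f x))" for l j
    by (intro integrable_bounded_support bounded_support_partial bounded_support_mult assms
         continuous_of_C_1 C)
  then show ?thesis
    unfolding eq using C assms
    by (simp add: integral_partial_eq_0 bounded_support_mult del: C_k_on.simps)
qed

lemma integral_rot_mult:
  assumes f: "C_k_on 1 UNIV f" and g: "C_k_on 1 UNIV g" and bs: "bounded_support f"
  shows "(LINT x|lborel. rot i k f x * g x) = - (LINT x|lborel. f x * rot i k g x)"
proof -
  have c: "continuous_on UNIV f" "continuous_on UNIV g" "continuous_on UNIV (rot i k f)" "continuous_on UNIV (rot i k g)"
    by (intro continuous_of_C_1 f g)+
  have "(LINT x|lborel. rot i k (\<lambda>x. f x * g x) x) = 0"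
    by (intro integral_rot_eq_0 C_k_intros f g bounded_support_mult bs)
  also have "(LINT x|lborel. rot i k (\<lambda>x. f x * g x) x) = (LINT x|lborel. f x * rot i k g x) + (LINT x|lborel. rot i k f x * g x)"
    unfolding rot_mult[OF f g]
    by (intro Bochner_Integration.integral_add integrable_mult_bounded_support c bs bounded_support_rot)
  finally show ?thesis by linarith
qed

text \<open>The field \<open>x\<close> has divergence \<open>CARD('n)\<close>; the identity comes
  from integrating the divergence of \<open>x\<close> times \<open>f x * g x\<close>.\<close>

lemma integral_euler_mult:
  fixes f g :: "real^'n \<Rightarrow> real"
  assumes f: "C_k_on 1 UNIV f" and g: "C_k_on 1 UNIV g" and bs: "bounded_support f"
  shows "(LINT x|lborel. euler f x * g x) = - (LINT x|lborel. f x * euler g x) - CARD('n) * (LINT x|lborel. f x * g x)"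
proof -
  have c: "continuous_on UNIV f" "continuous_on UNIV g" "continuous_on UNIV (euler f)" "continuous_on UNIV (euler g)"
    by (intro continuous_of_C_1 f g)+
  let ?q = "\<lambda>x. f x * g x"
  have q: "C_k_on 1 UNIV ?q" by (intro C_k_intros f g)
  have i: "integrable lborel (\<lambda>x. euler f x * g x)" "integrable lborel (\<lambda>x. f x * euler g x)" "integrable lborel ?q"
    by (intro integrable_mult_bounded_support c bs bounded_support_euler)+
  have C: "C_k_on 1 UNIV (\<lambda>x. x $ j * ?q x)" for j by (intro C_k_intros q)
  have int: "integrable lborel (partial l (\<lambda>x. x $ j * ?q x))" for l j
    by (intro integrable_bounded_support bounded_support_partial bounded_support_mult bs
         continuous_of_C_1 C)
  have "0 = (LINT x|lborel. (\<Sum>i\<in>UNIV. partial i (\<lambda>x. x $ i * ?q x) x))"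
    using int C bs by (simp add: integral_partial_eq_0 bounded_support_mult del: C_k_on.simps)
  also have "\<dots> = (LINT x|lborel. f x * euler g x + euler f x * g x + CARD('n) * ?q x)"
    unfolding partial_nth_mult[OF q] fun_cong[OF euler_mult[OF f g], symmetric]
    by (simp add: euler_def sum.distrib)
  also have "\<dots> = (LINT x|lborel. f x * euler g x) + (LINT x|lborel. euler f x * g x) + CARD('n) * (LINT x|lborel. ?q x)"
    using i by simp
  finally show ?thesis by linarith
qed

text \<open>Every rotation is antisymmetric. Moving one of the two rotations to \<open>g\<close>
  gives the Dirichlet form of the first claim, moving both gives symmetry.\<close>

lemma integral_sph_mult:
  assumes f: "C_k_on 2 UNIV f" and g: "C_k_on 2 UNIV g" and bs: "bounded_support f"
  shows "(LINT x|lborel. sph f x * g x)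
    = (\<Sum>i\<in>UNIV. \<Sum>k\<in>UNIV. LINT x|lborel. rot i k f x * rot i k g x) / 2" (is ?A)
    and "(LINT x|lborel. sph f x * g x) = (LINT x|lborel. f x * sph g x)" (is ?B)
proof -
  have 1: "C_k_on 1 UNIV f" "C_k_on 1 UNIV g" "C_k_on 1 UNIV (rot i k f)" "C_k_on 1 UNIV (rot i k g)" for i k
    by (intro f g C_k_on_1_of_2 C_1_of_C_2)+
  have c: "continuous_on UNIV f" "continuous_on UNIV g"
     "continuous_on UNIV (rot i k f)" "continuous_on UNIV (rot i k (rot i k f))"
     "continuous_on UNIV (rot i k g)" "continuous_on UNIV (rot i k (rot i k g))" for i k
    by (intro 1 continuous_of_C_1)+
  have i: "integrable lborel (\<lambda>x. rot i k (rot i k f) x * g x)"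
     "integrable lborel (\<lambda>x. f x * rot i k (rot i k g) x)" for i k
    by (intro integrable_mult_bounded_support c bs bounded_support_rot)+
  have "(LINT x|lborel. sph f x * g x)
      = (LINT x|lborel. - (\<Sum>i\<in>UNIV. \<Sum>k\<in>UNIV. rot i k (rot i k f) x * g x) / 2)"
    by (simp add: sph_def sum_distrib_right)
  also have "\<dots> = - (\<Sum>i\<in>UNIV. \<Sum>k\<in>UNIV. LINT x|lborel. rot i k (rot i k f) x * g x) / 2"
    using i by simp
  also have "\<dots> = (\<Sum>i\<in>UNIV. \<Sum>k\<in>UNIV. LINT x|lborel. rot i k f x * rot i k g x) / 2"
    by (simp add: integral_rot_mult 1 bs bounded_support_rot sum_negf del: C_k_on.simps One_nat_def)
  finally show ?A .
  also have "\<dots> = - (\<Sum>i\<in>UNIV. \<Sum>k\<in>UNIV. LINT x|lborel. f x * rot i k (rot i k g) x) / 2"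
    by (simp add: integral_rot_mult 1 bs bounded_support_rot sum_negf del: C_k_on.simps One_nat_def)
  also have "\<dots> = (LINT x|lborel. - (\<Sum>i\<in>UNIV. \<Sum>k\<in>UNIV. f x * rot i k (rot i k g) x) / 2)"
    using i by simp
  also have "\<dots> = (LINT x|lborel. f x * sph g x)"
    by (simp add: sph_def sum_distrib_left)
  finally show ?B .
qed

section \<open>Commutation with dilations and the polar splitting of gradient and Laplacian\<close>

lemma partial_diff:
  assumes "C_k_on 1 UNIV f" "C_k_on 1 UNIV g"
  shows "partial i (\<lambda>x. f x - g x) = (\<lambda>x. partial i f x - partial i g x)"
proof
  fix x
  show "partial i (\<lambda>x. f x - g x) x = partial i f x - partial i g x"
    unfolding partial_eqI[OF has_derivative_diff[OF C_1_has_derivative[OF assms(1)] C_1_has_derivative[OF assms(2)]]]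
    by (simp add: partial_def)
qed

lemma partial_rot:
  assumes "C_k_on 2 UNIV f"
  shows "partial l (rot i k f) x =
     (x $ i * partial l (partial k f) x + (if l = i then partial k f x else 0))
     - (x $ k * partial l (partial i f) x + (if l = k then partial i f x else 0))"
proof -
  have 1: "C_k_on 1 UNIV (partial j f)" for j by (rule C_1_of_C_2(1)[OF assms])
  have "C_k_on 1 UNIV (\<lambda>x. x $ l * partial j f x)" for l j
    by (intro C_k_on_mult C_k_on_nth open_UNIV 1)
  then show ?thesis
    unfolding rot_def[abs_def] by (subst partial_diff) (simp_all only: partial_nth_mult[OF 1])
qed

text \<open>Rotations commute with dilations. In coordinates the second-order terms match by
  symmetry of second derivatives, and the first-order terms agree on both sides.\<close>

lemma rot_euler_commute:
  assumes f: "C_k_on 2 UNIV f"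
  shows "rot i k (euler f) = euler (rot i k f)"
proof
  fix x
  note [simp del] = C_k_on.simps One_nat_def
  have 1: "C_k_on 1 UNIV (partial j f)" for j
    by (intro C_1_of_C_2 f)
  then have 2: "C_k_on 1 UNIV (\<lambda>x. x $ l * partial j f x)" for l j
    by (intro C_k_on_mult C_k_on_nth open_UNIV)
  have e: "partial j (euler f) x = (\<Sum>l\<in>UNIV. x $ l * partial l (partial j f) x) + partial j f x" for j
    unfolding euler_def[abs_def]
    by (simp add: partial_sum 2 partial_nth_mult 1 sum.distrib partial_commute[OF f, of j])
  have "euler (rot i k f) x = (\<Sum>l\<in>UNIV. x $ i * (x $ l * partial l (partial k f) x)
      - x $ k * (x $ l * partial l (partial i f) x)
      + (if l = i then x $ l * partial k f x else 0) - (if l = k then x $ l * partial i f x else 0))"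
    unfolding euler_def partial_rot[OF f] by (intro sum.cong) (auto simp: algebra_simps)
  also have "\<dots> = rot i k (euler f) x"
    unfolding rot_def e by (simp add: sum.distrib sum_subtractf sum_distrib_left algebra_simps)
  finally show "rot i k (euler f) x = euler (rot i k f) x" ..
qed

text \<open>Lagrange's identity; summing over ordered pairs produces the factor 2.\<close>

lemma sum_power2_minor:
  fixes a p :: "'n::finite \<Rightarrow> real"
  shows "(\<Sum>i\<in>UNIV. \<Sum>k\<in>UNIV. (a i * p k - a k * p i)\<^sup>2)
    = 2 * (\<Sum>i\<in>UNIV. (a i)\<^sup>2) * (\<Sum>i\<in>UNIV. (p i)\<^sup>2) - 2 * (\<Sum>i\<in>UNIV. a i * p i)\<^sup>2"
proof -
  have "(\<Sum>i\<in>UNIV. \<Sum>k\<in>UNIV. (a i * p k - a k * p i)\<^sup>2)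
     = (\<Sum>i\<in>UNIV. \<Sum>k\<in>UNIV. (a i)\<^sup>2 * (p k)\<^sup>2) + (\<Sum>i\<in>UNIV. \<Sum>k\<in>UNIV. (a k)\<^sup>2 * (p i)\<^sup>2)
       - 2 * (\<Sum>i\<in>UNIV. \<Sum>k\<in>UNIV. (a i * p i) * (a k * p k))"
    by (simp add: sum.distrib[symmetric] sum_subtractf[symmetric] sum_distrib_left power2_eq_square algebra_simps)
  also have "(\<Sum>i\<in>UNIV. \<Sum>k\<in>UNIV. (a k)\<^sup>2 * (p i)\<^sup>2) = (\<Sum>i\<in>UNIV. \<Sum>k\<in>UNIV. (a i)\<^sup>2 * (p k)\<^sup>2)"
    by (rule sum.swap)
  finally show ?thesis by (simp add: sum_product power2_eq_square)
qed

text \<open>Lagrange's identity for the position vector and the gradient separates the radial from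
  the angular derivatives. The factor \<open>(norm x)\<^sup>2\<close> keeps it valid at the
  origin.\<close>

lemma norm_gradient_split:
  "(norm x)\<^sup>2 * (\<Sum>i\<in>UNIV. (partial i f x)\<^sup>2)
    = (euler f x)\<^sup>2 + (\<Sum>i\<in>UNIV. \<Sum>k\<in>UNIV. (rot i k f x)\<^sup>2) / 2"
  unfolding rot_def euler_def sum_power2_minor
  by (simp add: norm_vec_def L2_set_def sum_nonneg diff_divide_distrib)

text \<open>The polar form of the Laplacian, multiplied by \<open>(norm x)\<^sup>2\<close>. Both
  sides are expanded in the coordinates, the first derivatives \<open>p\<close> and the Hessian
  \<open>H\<close>.\<close>

lemma laplacian_split:
  fixes f :: "real^'n \<Rightarrow> real"
  assumes f: "C_k_on 2 UNIV f"
  shows "(norm x)\<^sup>2 * (\<Sum>i\<in>UNIV. partial i (partial i f) x)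
    = euler (euler f) x + (real CARD('n) - 2) * euler f x - sph f x"
proof -
  note [simp del] = C_k_on.simps One_nat_def
  have 1: "C_k_on 1 UNIV (partial j f)" for j
    by (intro C_1_of_C_2 f)
  then have 2: "C_k_on 1 UNIV (\<lambda>x. x $ l * partial j f x)" for l j
    by (intro C_k_on_mult C_k_on_nth open_UNIV)
  define H where "H k i = partial k (partial i f) x" for k i
  define Q where "Q = (\<Sum>i\<in>UNIV. \<Sum>k\<in>UNIV. x $ i * x $ k * H i k)"
  define p where "p i = partial i f x" for i
  have nx: "(norm x)\<^sup>2 = (\<Sum>i\<in>UNIV. (x $ i)\<^sup>2)"
    by (simp add: norm_vec_def L2_set_def sum_nonneg)
  have S: "euler f x = (\<Sum>i\<in>UNIV. x $ i * p i)" by (simp add: euler_def p_def)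
  have EE: "euler (euler f) x = euler f x + Q"
  proof -
    have "partial j (euler f) x = (\<Sum>l\<in>UNIV. x $ l * H j l) + p j" for j
      unfolding euler_def[abs_def] H_def p_def
      by (simp add: partial_sum 2 partial_nth_mult 1 sum.distrib)
    then show ?thesis unfolding S Q_def
      by (subst euler_def) (simp add: distrib_left sum.distrib sum_distrib_left mult_ac)
  qed
  have r: "partial l (rot i k f) x =
     (x $ i * H l k + (if l = i then p k else 0)) - (x $ k * H l i + (if l = k then p i else 0))" for l i k
    unfolding partial_rot[OF f] H_def p_def ..
  \<comment> \<open>First-order terms arise where the outer rotation differentiates the coefficients
    of the inner one. The conditional terms correct the diagonal \<open>i = k\<close>, where the
    rotation is zero.\<close>
  have "- 2 * sph f x = (\<Sum>i\<in>UNIV. \<Sum>k\<in>UNIV. (x $ i)\<^sup>2 * H k k + (x $ k)\<^sup>2 * H i i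
     - x $ i * x $ k * H k i - x $ i * x $ k * H i k - x $ i * p i - x $ k * p k
     + (if k = i then x $ i * p k else 0) + (if k = i then x $ k * p i else 0))"
    unfolding sph_def rot_def[of _ _ "rot _ _ f"] r
    by (simp, intro sum.cong refl) (auto simp: power2_eq_square algebra_simps)
  also have "\<dots> = (\<Sum>i\<in>UNIV. \<Sum>k\<in>UNIV. (x $ i)\<^sup>2 * H k k) + (\<Sum>i\<in>UNIV. \<Sum>k\<in>UNIV. (x $ k)\<^sup>2 * H i i)
     - (\<Sum>i\<in>UNIV. \<Sum>k\<in>UNIV. x $ i * x $ k * H k i) - Q - 2 * CARD('n) * euler f x + 2 * euler f x"
    by (simp add: sum.distrib sum_subtractf S Q_def sum_distrib_left mult_ac sum_negf)
  also have "(\<Sum>i\<in>UNIV. \<Sum>k\<in>UNIV. (x $ k)\<^sup>2 * H i i) = (\<Sum>i\<in>UNIV. \<Sum>k\<in>UNIV. (x $ i)\<^sup>2 * H k k)"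
    by (rule sum.swap)
  also have "(\<Sum>i\<in>UNIV. \<Sum>k\<in>UNIV. x $ i * x $ k * H k i) = Q"
    unfolding Q_def by (subst sum.swap) (simp add: mult_ac)
  also have "(\<Sum>i\<in>UNIV. \<Sum>k\<in>UNIV. (x $ i)\<^sup>2 * H k k) = (norm x)\<^sup>2 * (\<Sum>i\<in>UNIV. H i i)"
    by (simp add: nx sum_product)
  finally show ?thesis unfolding EE H_def by (simp add: algebra_simps)
qed

section \<open>Polynomials as sums of eigenfunctions\<close>

lemma rot_const [simp]: "rot i k (\<lambda>x. c) = (\<lambda>x. 0)"
  by (simp add: rot_def fun_eq_iff)

lemma sph_const [simp]: "sph (\<lambda>x. c) = (\<lambda>x. 0)"
  by (simp add: sph_def[abs_def])

inductive hom_poly :: "nat \<Rightarrow> (real^'n \<Rightarrow> real) \<Rightarrow> bool" where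
  hom_poly_0: "hom_poly k (\<lambda>x. 0)"
| hom_poly_const: "hom_poly 0 (\<lambda>x. c)"
| hom_poly_nth: "hom_poly 1 (\<lambda>x. x $ i)"
| hom_poly_add: "hom_poly k p \<Longrightarrow> hom_poly k q \<Longrightarrow> hom_poly k (\<lambda>x. p x + q x)"
| hom_poly_mult: "hom_poly j p \<Longrightarrow> hom_poly k q \<Longrightarrow> hom_poly (j + k) (\<lambda>x. p x * q x)"

lemma C_k_on_hom_poly: "hom_poly k p \<Longrightarrow> C_k_on m UNIV p"
  by (induction rule: hom_poly.induct)
    (rule C_k_on_const C_k_on_nth C_k_on_add C_k_on_mult open_UNIV; assumption?)+

lemma hom_poly_sum: "finite I \<Longrightarrow> (\<And>i. i \<in> I \<Longrightarrow> hom_poly k (p i)) \<Longrightarrow> hom_poly k (\<lambda>x. \<Sum>i\<in>I. p i x)"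
  by (induction I rule: finite_induct) (simp_all add: hom_poly_0 hom_poly_add)

text \<open>The second conjunct carries the induction through products: for a factor of degree 0 the
  truncated degree would give a wrong count, but then the corresponding term of the Leibniz rule
  vanishes.\<close>

lemma hom_poly_partial:
  "hom_poly k p \<Longrightarrow> hom_poly (k - 1) (partial i p) \<and> (k = 0 \<longrightarrow> partial i p = (\<lambda>x. 0))"
proof (induction rule: hom_poly.induct)
  case (hom_poly_nth j)
  then show ?case by (auto simp: partial_nth hom_poly_const)
next
  case (hom_poly_add k p q)
  then show ?case
    unfolding partial_add[OF C_k_on_hom_poly[OF hom_poly_add(1)] C_k_on_hom_poly[OF hom_poly_add(2)]]
    using hom_poly_add(3,4) by (simp add: hom_poly.hom_poly_add)
next
  case (hom_poly_mult j p k q)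
  have "hom_poly (j + k - 1) (\<lambda>x. p x * partial i q x)"
    using hom_poly.hom_poly_mult[OF hom_poly_mult(1), of "k - 1" "partial i q"] hom_poly_mult(4)
    by (cases k) (simp_all add: hom_poly_0)
  moreover have "hom_poly (j + k - 1) (\<lambda>x. partial i p x * q x)"
    using hom_poly.hom_poly_mult[OF _ hom_poly_mult(2), of "j - 1" "partial i p"] hom_poly_mult(3)
    by (cases j) (simp_all add: hom_poly_0)
  ultimately show ?case
    unfolding partial_mult[OF C_k_on_hom_poly[OF hom_poly_mult(1)] C_k_on_hom_poly[OF hom_poly_mult(2)]]
    using hom_poly_mult(3,4) by (simp add: hom_poly.hom_poly_add)
qed (simp_all add: hom_poly_0)

lemma euler_nth: "euler (\<lambda>x. x $ j) = (\<lambda>x. x $ j)"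
  by (simp add: euler_def fun_eq_iff partial_nth if_distrib[of "(*) _"] cong: if_cong)

lemma euler_hom_poly: "hom_poly k p \<Longrightarrow> euler p = (\<lambda>x. real k * p x)"
proof (induction rule: hom_poly.induct)
  case (hom_poly_add k p q)
  then show ?case
    unfolding euler_add[OF C_k_on_hom_poly[OF hom_poly_add(1)] C_k_on_hom_poly[OF hom_poly_add(2)]]
    by (simp add: distrib_left)
next
  case (hom_poly_mult j p k q)
  then show ?case
    unfolding euler_mult[OF C_k_on_hom_poly[OF hom_poly_mult(1)] C_k_on_hom_poly[OF hom_poly_mult(2)]]
    by (simp add: algebra_simps)
qed (auto simp: euler_nth, auto simp: euler_def fun_eq_iff)

lemma hom_poly_norm_power2: "hom_poly 2 (\<lambda>x::real^'n. (norm x)\<^sup>2)"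
proof -
  have "hom_poly (1 + 1) (\<lambda>x::real^'n. \<Sum>i\<in>UNIV. x $ i * x $ i)"
    by (intro hom_poly_sum hom_poly_mult hom_poly_nth) auto
  moreover have "(\<lambda>x::real^'n. \<Sum>i\<in>UNIV. x $ i * x $ i) = (\<lambda>x. (norm x)\<^sup>2)"
    by (simp add: norm_vec_def L2_set_def sum_nonneg power2_eq_square[symmetric])
  moreover have "1 + 1 = (2 :: nat)" by simp
  ultimately show ?thesis by (simp only:)
qed

lemma partial_norm_power2: "partial i (\<lambda>x::real^'a. (norm x)\<^sup>2) = (\<lambda>x. 2 * x $ i)"
proof
  fix x :: "real^'a"
  have "((\<lambda>x. (norm x)\<^sup>2) has_derivative (\<lambda>h. x \<bullet> h + h \<bullet> x)) (at x)"
    unfolding power2_norm_eq_inner by (intro has_derivative_inner has_derivative_ident)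
  from partial_eqI[OF this] show "partial i (\<lambda>x. (norm x)\<^sup>2) x = 2 * x $ i"
    by (simp add: inner_axis inner_axis')
qed

lemma rot_norm_power2: "rot i k (\<lambda>x. (norm x)\<^sup>2) = (\<lambda>x. 0)"
  by (simp add: rot_def partial_norm_power2 fun_eq_iff)

lemma sphere_eigenvalue_strict_mono:
  assumes "n \<ge> 2" "i < k"
  shows "sphere_eigenvalue n i < sphere_eigenvalue n k"
proof -
  have "real i * (real i + real n - 2) \<le> real i * (real k + real n - 2)"
    using assms by (intro mult_left_mono) auto
  also have "\<dots> < real k * (real k + real n - 2)"
    using assms by (intro mult_strict_right_mono) auto
  finally show ?thesis by (simp add: sphere_eigenvalue_def)
qed

text \<open>Euler's identity turns the radial part of \<open>laplacian_split\<close> into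
  \<open>k * k + (n - 2) * k\<close> with \<open>n = CARD('n)\<close>, which is the
  \<open>k\<close>-th eigenvalue. Harmonic polynomials are thus eigenfunctions, and the Laplacian
  measures the defect of the others.\<close>

lemma sph_hom_poly:
  assumes "hom_poly k (p :: real^'n \<Rightarrow> real)"
  shows "sph p = (\<lambda>x. sphere_eigenvalue CARD('n) k * p x + (- 1) * ((norm x)\<^sup>2 * (\<Sum>i\<in>UNIV. partial i (partial i p) x)))"
  using laplacian_split[OF C_k_on_hom_poly[OF assms]] euler_hom_poly[OF assms]
    euler_cmult[OF C_k_on_hom_poly[OF assms], of "real k"]
  by (simp add: fun_eq_iff sphere_eigenvalue_def algebra_simps)

text \<open>Each \<open>h i\<close> plays the role of a spherical harmonic of degree \<open>i\<close>, times a radial function.\<close>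

definition sph_eigenfunctions :: "(nat \<Rightarrow> real^'n \<Rightarrow> real) \<Rightarrow> bool" where
  "sph_eigenfunctions h \<longleftrightarrow>
    (\<forall>i. (\<forall>m. C_k_on m UNIV (h i)) \<and> sph (h i) = (\<lambda>x. sphere_eigenvalue CARD('n) i * h i x))"

text \<open>Induction on the degree: the Laplacian of \<open>p\<close> has degree
  \<open>k - 2\<close> and is already decomposed. Multiples of \<open>(norm x)\<^sup>2\<close> times
  its components correct \<open>p\<close> to an eigenfunction for the \<open>k\<close>-th
  eigenvalue, and they are themselves eigenfunctions of lower index.\<close>

lemma hom_poly_eigenfunctions:
  fixes p :: "real^'n \<Rightarrow> real"
  assumes n: "CARD('n) \<ge> 2" and p: "hom_poly k p"
  shows "\<exists>h. sph_eigenfunctions h \<and> p = (\<lambda>x. \<Sum>i\<le>k. h i x)"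
  using p
proof (induction k arbitrary: p rule: less_induct)
  case (less k)
  let ?l = "sphere_eigenvalue CARD('n)"
  define q where "q = (\<lambda>x. \<Sum>i\<in>UNIV. partial i (partial i p) x)"
  \<comment> \<open>The bound \<open>i < k - 1\<close> means \<open>i \<le> k - 2\<close> for
    \<open>k \<ge> 2\<close>, and is an empty range for \<open>k < 2\<close>, where the Laplacian is
    zero.\<close>
  obtain g where g: "sph_eigenfunctions g" and qg: "q = (\<lambda>x. \<Sum>i<k-1. g i x)"
  proof (cases "k < 2")
    case True
    have "partial i (partial i p) = (\<lambda>x. 0)" for i
    proof -
      have "hom_poly 0 (partial i p)"
        using hom_poly_partial[OF less.prems, of i] True by (cases k) auto
      then show ?thesis using hom_poly_partial by blast
    qed
    then have "q = (\<lambda>x. 0)" by (simp add: q_def)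
    moreover have "sph_eigenfunctions (\<lambda>i x. 0 :: real)"
      by (simp add: sph_eigenfunctions_def C_k_on_const del: C_k_on.simps)
    ultimately show ?thesis using that[of "\<lambda>i x. 0"] by simp
  next
    case False
    have "hom_poly (k - 1 - 1) (partial i (partial i p))" for i
      using hom_poly_partial less.prems by blast
    then have "hom_poly (k - 2) q"
      unfolding q_def by (intro hom_poly_sum) (auto simp: numeral_2_eq_2)
    moreover have "{..k - 2} = {..<k - 1}" using False by auto
    ultimately show ?thesis using less.IH[of "k - 2" q] False that by auto
  qed
  \<comment> \<open>The coefficients solve \<open>(?l k - ?l i) * c i = - 1\<close>, so that the
    corrections cancel the defect \<open>(norm x)\<^sup>2 * q x\<close> of \<open>p\<close>.\<close>
  define c where "c i = - 1 / (?l k - ?l i)" for i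
  define r where "r i = (\<lambda>x. c i * ((norm x)\<^sup>2 * g i x))" for i
  \<comment> \<open>The corrections added to \<open>p\<close> at index \<open>k\<close> are
    subtracted again at their own indices, so the sum is \<open>p\<close>; index
    \<open>k - 1\<close> gets zero when \<open>k > 0\<close>.\<close>
  define h where "h i = (if i < k - 1 then (\<lambda>x. - 1 * r i x) else if i = k then (\<lambda>x. p x + (\<Sum>j<k-1. r j x)) else (\<lambda>x. 0))" for i
  have Cg: "C_k_on m UNIV (g i)" and sg: "sph (g i) = (\<lambda>x. ?l i * g i x)" for m i
    using g by (auto simp: sph_eigenfunctions_def)
  note Cn = C_k_on_hom_poly[OF hom_poly_norm_power2]
  have C: "C_k_on m UNIV (r i)" for m i
    unfolding r_def by (intro C_k_intros Cg Cn)
  have Cs: "C_k_on m UNIV (\<lambda>x. \<Sum>j<k-1. r j x)" for m by (intro C_k_intros C) auto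
  have Cp: "C_k_on m UNIV p" for m by (rule C_k_on_hom_poly[OF less.prems])
  have sr: "sph (r i) = (\<lambda>x. ?l i * r i x)" for i
    unfolding r_def by (subst sph_cmult, intro C_k_intros Cg Cn)
      (simp add: sph_radial_mult[OF Cg Cn rot_norm_power2] sg mult.left_commute)
  have "sph (\<lambda>x. p x + (\<Sum>j<k-1. r j x)) = (\<lambda>x. ?l k * (p x + (\<Sum>j<k-1. r j x)))"
  proof
    fix x
    have "?l k * r j x - ?l j * r j x = - ((norm x)\<^sup>2 * g j x)" if "j < k - 1" for j
    proof -
      have "j < k" using that by linarith
      then have "?l k - ?l j \<noteq> 0" using sphere_eigenvalue_strict_mono[OF n, of j k] by simp
      then have "(?l k - ?l j) * c j = - 1" by (simp add: c_def)
      then have "((?l k - ?l j) * c j) * ((norm x)\<^sup>2 * g j x) = - 1 * ((norm x)\<^sup>2 * g j x)" by simp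
      then show ?thesis by (simp add: r_def algebra_simps)
    qed
    then have "(\<Sum>j<k-1. ?l k * r j x - ?l j * r j x) = - ((norm x)\<^sup>2 * q x)"
      by (simp add: qg sum_distrib_left sum_negf)
    then have "(\<Sum>j<k-1. ?l k * r j x) - (\<Sum>j<k-1. ?l j * r j x) = - ((norm x)\<^sup>2 * q x)"
      unfolding sum_subtractf .
    moreover have "sph p x = ?l k * p x - (norm x)\<^sup>2 * q x"
      unfolding sph_hom_poly[OF less.prems] q_def by simp
    moreover have "sph (\<lambda>x. p x + (\<Sum>j<k-1. r j x)) x = sph p x + (\<Sum>j<k-1. ?l j * r j x)"
      by (simp only: sph_add[OF Cp Cs] sph_sum[OF finite_lessThan C] sr)
    ultimately show "sph (\<lambda>x. p x + (\<Sum>j<k-1. r j x)) x = ?l k * (p x + (\<Sum>j<k-1. r j x))"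
      unfolding distrib_left sum_distrib_left by linarith
  qed
  moreover have "sph (\<lambda>x. - 1 * r i x) = (\<lambda>x. ?l i * (- 1 * r i x))" for i
    using sph_cmult[OF C, of "- 1"] by (simp add: sr)

  moreover have "C_k_on m UNIV (\<lambda>x. - 1 * r i x)" for m i by (intro C_k_intros C)
  ultimately have "sph_eigenfunctions h"
    unfolding sph_eigenfunctions_def h_def
    by (simp add: C_k_on_add Cp Cs C_k_on_const del: C_k_on.simps mult_minus1 One_nat_def)
  moreover have "p x = (\<Sum>i\<le>k. h i x)" for x
  proof -
    have "(\<Sum>i\<le>k. h i x) = (\<Sum>i\<in>insert k {..<k-1}. h i x)"
      by (rule sum.mono_neutral_right) (auto simp: h_def)
    also have "\<dots> = h k x + (\<Sum>i<k-1. h i x)" by simp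
    also have "\<dots> = p x"
    proof -
      have "\<not> k < k - 1" by linarith
      then show ?thesis by (simp add: h_def sum_negf)
    qed
    finally show ?thesis ..
  qed
  ultimately show ?case by blast
qed

section \<open>From homogeneous to arbitrary polynomials\<close>

inductive hom_poly_span :: "(real^'n \<Rightarrow> real) \<Rightarrow> bool" where
  hom_poly_span_base: "hom_poly k p \<Longrightarrow> hom_poly_span p"
| hom_poly_span_add: "hom_poly_span p \<Longrightarrow> hom_poly_span q \<Longrightarrow> hom_poly_span (\<lambda>x. p x + q x)"

lemma hom_poly_span_mult:
  assumes "hom_poly_span p" "hom_poly_span q"
  shows "hom_poly_span (\<lambda>x. p x * q x)"
  using assms(1)
proof induction
  case (hom_poly_span_base j p)
  show ?case
    using assms(2)
  proof induction
    case (hom_poly_span_base k q)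
    then show ?case using hom_poly_mult[OF \<open>hom_poly j p\<close>] hom_poly_span.hom_poly_span_base by blast
  next
    case (hom_poly_span_add q r)
    then show ?case using hom_poly_span.hom_poly_span_add by (simp only: distrib_left)
  qed
next
  case (hom_poly_span_add p q)
  then show ?case using hom_poly_span.hom_poly_span_add by (simp only: distrib_right)
qed

lemma hom_poly_span_of_polynomial:
  fixes p :: "real^'n \<Rightarrow> real"
  shows "real_polynomial_function p \<Longrightarrow> hom_poly_span p"
proof (induction rule: real_polynomial_function.induct)
  case (linear f)
  have "f x = (\<Sum>i\<in>UNIV. f (axis i 1) * x $ i)" for x
  proof -
    have "f x = f (\<Sum>i\<in>UNIV. x $ i *s axis i 1)" by (simp add: basis_expansion)
    also have "\<dots> = (\<Sum>i\<in>UNIV. x $ i * f (axis i 1))"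
      using bounded_linear.linear[OF linear]
      by (simp add: linear_sum linear_cmul scalar_mult_eq_scaleR)
    finally show ?thesis by (simp add: mult.commute)
  qed
  then have "f = (\<lambda>x. \<Sum>i\<in>UNIV. f (axis i 1) * x $ i)" by (rule ext)
  moreover have "hom_poly (0 + 1) (\<lambda>x. \<Sum>i\<in>UNIV. f (axis i 1) * x $ i)"
    by (intro hom_poly_sum hom_poly_mult hom_poly_const hom_poly_nth) auto
  ultimately show ?case using hom_poly_span_base by metis
next
  case (const c)
  then show ?case by (rule hom_poly_span_base[OF hom_poly_const])
qed (rule hom_poly_span_add hom_poly_span_mult; assumption)+

lemma polynomial_eigenfunctions:
  fixes p :: "real^'n \<Rightarrow> real"
  assumes n: "CARD('n) \<ge> 2" and p: "real_polynomial_function p"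
  shows "\<exists>h N. sph_eigenfunctions h \<and> p = (\<lambda>x. \<Sum>i\<le>N. h i x)"
  using hom_poly_span_of_polynomial[OF p]
proof induction
  case (hom_poly_span_base k p)
  then show ?case using hom_poly_eigenfunctions[OF n] by blast
next
  case (hom_poly_span_add p q)
  then obtain g M h N where g: "sph_eigenfunctions g" "p = (\<lambda>x. \<Sum>i\<le>M. g i x)"
    and h: "sph_eigenfunctions h" "q = (\<lambda>x. \<Sum>i\<le>N. h i x)" by blast
  \<comment> \<open>Padding with zero, an eigenfunction for every eigenvalue, lets both sums run up
    to \<open>max M N\<close> and be added index by index.\<close>
  define g' where "g' i = (if i \<le> M then g i else (\<lambda>x. 0))" for i
  define h' where "h' i = (if i \<le> N then h i else (\<lambda>x. 0))" for i
  have gh: "sph_eigenfunctions g'" "sph_eigenfunctions h'"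
    using g(1) h(1) unfolding sph_eigenfunctions_def g'_def h'_def
    by (simp_all add: C_k_on_const del: C_k_on.simps)
  then have "sph_eigenfunctions (\<lambda>i x. g' i x + h' i x)"
    unfolding sph_eigenfunctions_def
    by (simp add: C_k_on_add sph_add distrib_left del: C_k_on.simps)
  moreover have "(\<Sum>i\<le>max M N. g' i x + h' i x) = p x + q x" for x
  proof -
    have "(\<Sum>i\<le>max M N. g' i x) = p x" "(\<Sum>i\<le>max M N. h' i x) = q x"
      unfolding g(2) h(2) by (rule sum.mono_neutral_cong_right; auto simp: g'_def h'_def)+
    then show ?thesis by (simp add: sum.distrib)
  qed
  ultimately show ?case
    by (intro exI[of _ "\<lambda>i x. g' i x + h' i x"] exI[of _ "max M N"]) simp
qed

section \<open>The spectral gap\<close>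

lemma partial_compose:
  assumes "(\<phi> has_real_derivative D) (at (g x))" "(g has_derivative g') (at x)"
  shows "partial i (\<lambda>x. \<phi> (g x)) x = partial i g x * D"
  using partial_eqI[OF DERIV_compose_FDERIV[OF assms], of i] partial_eqI[OF assms(2), of i] by simp

lemma rot_compose:
  assumes "(\<phi> has_real_derivative D) (at (g x))" "(g has_derivative g') (at x)"
  shows "rot i k (\<lambda>x. \<phi> (g x)) x = rot i k g x * D"
  by (simp add: rot_def partial_compose[where D = D, OF assms] algebra_simps)

lemma integral_square_nonneg: "(LINT x|lborel. (f x :: real)\<^sup>2) \<ge> 0"
  by (rule Bochner_Integration.integral_nonneg) simp

text \<open>Duality in place of a spectral decomposition: the operator \<open>sph - m\<close> is explicitly invertible
  on finite sums of eigenfunctions, with inverse of norm at most \<open>1/d\<close>.\<close>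

lemma eigenfunction_duality:
  fixes u \<psi> :: "real^'n \<Rightarrow> real" and N :: nat
  assumes h: "sph_eigenfunctions h" and n: "CARD('n) \<ge> 2"
    and u: "C_k_on 2 UNIV u" "bounded_support u"
    and \<psi>: "C_k_on 2 UNIV \<psi>" "bounded_support \<psi>" "\<And>i k. rot i k \<psi> = (\<lambda>x. 0)"
    and m: "\<And>i. \<bar>sphere_eigenvalue CARD('n) i - m\<bar> \<ge> d" "d > 0"
  defines "v \<equiv> \<lambda>x. \<psi> x * (\<Sum>i\<le>N. h i x)"
  shows "2 * d\<^sup>2 * (LINT x|lborel. u x * v x)
    \<le> (LINT x|lborel. (sph u x - m * u x)\<^sup>2) + d\<^sup>2 * (LINT x|lborel. (v x)\<^sup>2)"
proof -
  let ?l = "sphere_eigenvalue CARD('n)"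
  \<comment> \<open>Since the cutoff is radial, these are eigenfunctions with bounded support for
    the same eigenvalues.\<close>
  define e where "e i = (\<lambda>x. \<psi> x * h i x)" for i
  have hC: "C_k_on 2 UNIV (h i)" and hs: "sph (h i) = (\<lambda>x. ?l i * h i x)" for i
    using h unfolding sph_eigenfunctions_def by blast+
  have eC: "C_k_on 2 UNIV (e i)" for i
    unfolding e_def by (intro C_k_on_mult \<psi> hC open_UNIV)
  have eb: "bounded_support (e i)" for i
    unfolding e_def by (intro bounded_support_mult \<psi>)
  have es: "sph (e i) = (\<lambda>x. ?l i * e i x)" for i
    by (simp add: e_def sph_radial_mult[OF hC \<psi>(1,3)] hs mult.left_commute)
  have ec: "continuous_on UNIV (e i)" for i
    using eC by (rule C_k_on_continuous)
  have uc: "continuous_on UNIV u" "continuous_on UNIV (sph u)"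
    using u C_k_on_continuous C_1_of_C_2(4) by blast+
  have ei: "integrable lborel (\<lambda>x. e i x * e j x)" for i j
    by (intro integrable_mult_bounded_support ec eb)
  have ui: "integrable lborel (\<lambda>x. u x * e i x)" "integrable lborel (\<lambda>x. sph u x * e i x)" for i
    by (intro integrable_mult_bounded_support ec uc u bounded_support_sph)+
  \<comment> \<open>Symmetry of \<open>sph\<close> and distinctness of the eigenvalues.\<close>
  have orth: "(LINT x|lborel. e i x * e j x) = 0" if "i \<noteq> j" for i j
  proof -
    have "(LINT x|lborel. ?l i * e i x * e j x) = (LINT x|lborel. e i x * (?l j * e j x))"
      using integral_sph_mult(2)[OF eC eC eb, of i j] by (simp only: es)
    then have "?l i * (LINT x|lborel. e i x * e j x) = ?l j * (LINT x|lborel. e i x * e j x)"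
      by (simp add: mult.assoc mult.left_commute[of _ "?l j"])
    moreover have "?l i \<noteq> ?l j"
      using sphere_eigenvalue_strict_mono[OF n] that by (metis less_irrefl linorder_neqE_nat)
    ultimately show ?thesis by simp
  qed
  have comb: "(LINT x|lborel. (\<Sum>i\<le>N. c i * e i x)\<^sup>2) = (\<Sum>i\<le>N. (c i)\<^sup>2 * (LINT x|lborel. (e i x)\<^sup>2))" for c
  proof -
    have "(LINT x|lborel. (\<Sum>i\<le>N. c i * e i x)\<^sup>2)
        = (LINT x|lborel. (\<Sum>i\<le>N. \<Sum>j\<le>N. c i * c j * (e i x * e j x)))"
      by (simp add: power2_eq_square sum_product mult_ac)
    also have "\<dots> = (\<Sum>i\<le>N. \<Sum>j\<le>N. c i * c j * (LINT x|lborel. e i x * e j x))"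
      using ei by simp
    also have "\<dots> = (\<Sum>i\<le>N. \<Sum>j\<le>N. if j = i then c i * c i * (LINT x|lborel. e i x * e i x) else 0)"
      by (intro sum.cong refl) (auto simp: orth)
    finally show ?thesis by (simp add: power2_eq_square)
  qed
  define c where "c i = 1 / (?l i - m)" for i
  have c: "?l i - m \<noteq> 0" for i using m(1)[of i] m(2) by auto
  define F where "F = (\<lambda>x. sph u x - m * u x)"
  have Fe: "integrable lborel (\<lambda>x. F x * e i x)" for i
    using ui by (simp add: F_def left_diff_distrib mult.assoc)
  \<comment> \<open>\<open>w\<close> is the preimage of \<open>v\<close> under
    \<open>sph - m\<close>. By symmetry its pairing with \<open>F\<close> equals the pairing of
    \<open>u\<close> with \<open>v\<close>.\<close>
  define w where "w = (\<lambda>x. \<Sum>i\<le>N. c i * e i x)"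
  have vw: "v = (\<lambda>x. \<Sum>i\<le>N. 1 * e i x)" by (simp add: v_def e_def sum_distrib_left)
  have ue: "(LINT x|lborel. u x * e i x) = c i * (LINT x|lborel. F x * e i x)" for i
  proof -
    have "(LINT x|lborel. F x * e i x) = (LINT x|lborel. sph u x * e i x) - m * (LINT x|lborel. u x * e i x)"
      using ui by (simp add: F_def left_diff_distrib mult.assoc)
    also have "(LINT x|lborel. sph u x * e i x) = ?l i * (LINT x|lborel. u x * e i x)"
      unfolding integral_sph_mult(2)[OF u(1) eC u(2)] es by (simp add: mult.left_commute[of _ "?l i"])
    finally show ?thesis using c[of i] by (simp add: c_def field_simps)
  qed
  have wc: "continuous_on UNIV w" "continuous_on UNIV F"
    unfolding w_def F_def by (intro continuous_intros ec uc)+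
  have Fb: "bounded_support F"
    using bounded_support_add[OF bounded_support_sph[OF u(2)] bounded_support_mult(2)[OF u(2), of "\<lambda>_. - m"]]
    by (simp add: F_def)
  have wb: "bounded_support w"
    unfolding w_def by (intro bounded_support_sum bounded_support_mult eb) auto
  have Fw: "(LINT x|lborel. F x * w x) = (LINT x|lborel. u x * v x)"
  proof -
    have "(LINT x|lborel. F x * w x) = (LINT x|lborel. (\<Sum>i\<le>N. c i * (F x * e i x)))"
      by (simp add: w_def sum_distrib_left mult.left_commute)
    also have "\<dots> = (\<Sum>i\<le>N. LINT x|lborel. u x * e i x)"
      using Fe by (simp add: ue)
    also have "\<dots> = (LINT x|lborel. u x * v x)"
      using ui by (simp add: vw sum_distrib_left)
    finally show ?thesis .
  qed
  have i2: "integrable lborel (\<lambda>x. F x * F x)" "integrable lborel (\<lambda>x. F x * w x)" "integrable lborel (\<lambda>x. w x * w x)"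
    by (intro integrable_mult_bounded_support wc Fb wb)+
  \<comment> \<open>The weight \<open>d\<^sup>2\<close> is chosen so that the term in
    \<open>w\<close> becomes \<open>d\<^sup>2\<close> times the squared norm of \<open>v\<close>
    once the bound \<open>1 / d\<close> on the inverse is used.\<close>
  have "0 \<le> (LINT x|lborel. (F x - d\<^sup>2 * w x)\<^sup>2)" by (rule integral_square_nonneg)
  also have "\<dots> = (LINT x|lborel. F x * F x - 2 * d\<^sup>2 * (F x * w x) + d^4 * (w x * w x))"
    by (rule arg_cong[of _ _ "integral\<^sup>L lborel"]) (simp add: fun_eq_iff power2_eq_square power4_eq_xxxx algebra_simps)
  also have "\<dots> = (LINT x|lborel. (F x)\<^sup>2) - 2 * d\<^sup>2 * (LINT x|lborel. F x * w x) + d^4 * (LINT x|lborel. (w x)\<^sup>2)"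
    using i2 by (simp add: power2_eq_square[symmetric])
  finally have "2 * d\<^sup>2 * (LINT x|lborel. u x * v x) \<le> (LINT x|lborel. (F x)\<^sup>2) + d^4 * (LINT x|lborel. (w x)\<^sup>2)"
    by (simp add: Fw)
  moreover have "d^4 * (LINT x|lborel. (w x)\<^sup>2) \<le> d\<^sup>2 * (LINT x|lborel. (v x)\<^sup>2)"
  proof -
    have "d\<^sup>2 * (c i)\<^sup>2 \<le> 1" for i
    proof -
      have "d\<^sup>2 \<le> (?l i - m)\<^sup>2" using m(1)[of i] m(2) by (metis abs_le_square_iff abs_of_pos)
      then show ?thesis using c[of i] by (simp add: c_def power_divide)
    qed
    then have "(\<Sum>i\<le>N. (d\<^sup>2 * (c i)\<^sup>2) * (LINT x|lborel. (e i x)\<^sup>2)) \<le> (\<Sum>i\<le>N. 1 * (LINT x|lborel. (e i x)\<^sup>2))"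
      by (intro sum_mono mult_right_mono integral_square_nonneg)
    also have "\<dots> = (LINT x|lborel. (v x)\<^sup>2)" unfolding vw comb by simp
    also have "(\<Sum>i\<le>N. (d\<^sup>2 * (c i)\<^sup>2) * (LINT x|lborel. (e i x)\<^sup>2)) = d\<^sup>2 * (LINT x|lborel. (w x)\<^sup>2)"
      unfolding w_def comb by (simp add: sum_distrib_left mult.assoc)
    finally have "d\<^sup>2 * (d\<^sup>2 * (LINT x|lborel. (w x)\<^sup>2)) \<le> d\<^sup>2 * (LINT x|lborel. (v x)\<^sup>2)"
      by (rule mult_left_mono) simp
    then show ?thesis by (simp add: power4_eq_xxxx power2_eq_square mult.assoc)
  qed
  ultimately show ?thesis unfolding F_def by linarith
qed

text \<open>Take a radial cutoff that is positive on a ball larger than the support of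
  \<open>u\<close>. Then \<open>u\<close> is the cutoff times a continuous quotient, and the
  Weierstrass theorem approximates the quotient on the closed ball.\<close>

lemma polynomial_cutoff_dense:
  fixes u :: "real^'n \<Rightarrow> real"
  assumes u: "continuous_on UNIV u" "bounded_support u"
  obtains \<psi> where "C_k_on 2 UNIV \<psi>" "bounded_support \<psi>" "\<And>i k. rot i k \<psi> = (\<lambda>x. 0)"
    "\<And>\<epsilon>. \<epsilon> > 0 \<Longrightarrow> \<exists>p. real_polynomial_function p \<and> (\<forall>x. \<bar>u x - \<psi> x * p x\<bar> \<le> \<epsilon> * \<psi> x)"
proof -
  obtain B0 where B0: "\<And>x. u x \<noteq> 0 \<Longrightarrow> norm x \<le> B0"
    using u(2) by (auto simp: bounded_support_def)
  define B where "B = max B0 0"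
  have B: "u x = 0" if "norm x > B" for x
    using B0[of x] that by (force simp: B_def)
  have "B \<ge> 0" by (simp add: B_def)
  \<comment> \<open>With \<open>R > B\<close> the open sets \<open>norm x < R\<close> and
    \<open>norm x > B\<close> cover the space: \<open>\<psi>\<close> is positive on the first,
    \<open>u\<close> vanishes on the second.\<close>
  define R where "R = B + 1"
  define g where "g x = R\<^sup>2 + (- 1) * (norm x)\<^sup>2" for x :: "real^'n"
  define \<psi> where "\<psi> x = max 0 (g x) ^ Suc 2" for x
  have Cg: "C_k_on k UNIV g" for k
    unfolding g_def[abs_def]
    by (intro C_k_on_add C_k_on_mult C_k_on_const open_UNIV C_k_on_hom_poly[OF hom_poly_norm_power2])
  have C: "C_k_on 2 UNIV \<psi>"
    unfolding \<psi>_def[abs_def] by (intro C_k_on_max_0_power Cg open_UNIV)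
  have pos: "\<psi> x > 0 \<longleftrightarrow> norm x < R" and nn: "\<psi> x \<ge> 0" for x
  proof -
    have "norm x < R \<longleftrightarrow> g x > 0"
      using \<open>B \<ge> 0\<close> power_mono_iff[of R "norm x" 2] by (simp add: g_def R_def not_le[symmetric])
    then show "\<psi> x > 0 \<longleftrightarrow> norm x < R" by (auto simp: \<psi>_def max_def)
    show "\<psi> x \<ge> 0" by (simp add: \<psi>_def)
  qed
  have b: "bounded_support \<psi>"
    unfolding bounded_support_def using pos nn by (metis less_le order_less_imp_le)
  have rg: "rot i k g = (\<lambda>x. 0)" for i k
  proof -
    note Cn = C_k_on_hom_poly[OF hom_poly_norm_power2]
    show ?thesis
      unfolding g_def[abs_def] rot_add[OF C_k_on_const C_k_on_mult[OF open_UNIV C_k_on_const Cn]]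
        rot_cmult[OF Cn] rot_norm_power2 by simp
  qed
  have r: "rot i k \<psi> = (\<lambda>x. 0)" for i k
  proof
    fix x
    show "rot i k \<psi> x = 0"
      unfolding \<psi>_def[abs_def] numeral_2_eq_2
      using rot_compose[where \<phi> = "\<lambda>t. max 0 t ^ Suc (Suc (Suc 0))", OF has_real_derivative_max_0_power C_1_has_derivative[OF Cg]]
      by (simp add: rg)
  qed
  define q where "q x = u x / \<psi> x" for x
  have uq: "u x = \<psi> x * q x" for x
    using pos[of x] B[of x] by (cases "norm x < R") (auto simp: q_def R_def)
  have "continuous_on ({x. norm x < R} \<union> {x. norm x > B}) q"
  proof (rule continuous_on_open_Un)
    show "open {x::real^'n. norm x < R}" "open {x::real^'n. norm x > B}"
      by (intro open_Collect_less continuous_intros)+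
    show "continuous_on {x. norm x < R} q"
      unfolding q_def[abs_def] using pos
      by (intro continuous_on_divide continuous_on_subset[OF u(1)] continuous_on_subset[OF C_k_on_continuous[OF C]])
        (auto simp: less_le)
    have "continuous_on {x. norm x > B} (\<lambda>x. 0::real)" by simp
    then show "continuous_on {x. norm x > B} q"
      by (rule continuous_on_eq) (simp add: q_def B)
  qed
  moreover have "{x::real^'n. norm x < R} \<union> {x. norm x > B} = UNIV" by (auto simp: R_def)
  ultimately have cq: "continuous_on (cball 0 R) q"
    using continuous_on_subset by (metis subset_UNIV)
  have "\<exists>p. real_polynomial_function p \<and> (\<forall>x. \<bar>u x - \<psi> x * p x\<bar> \<le> \<epsilon> * \<psi> x)" if e: "\<epsilon> > 0" for \<epsilon>
  proof -
    obtain p where p: "real_polynomial_function p" "\<And>x. x \<in> cball 0 R \<Longrightarrow> \<bar>q x - p x\<bar> < \<epsilon>"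
      using Stone_Weierstrass_real_polynomial_function[OF compact_cball cq e] by blast
    have "\<bar>u x - \<psi> x * p x\<bar> \<le> \<epsilon> * \<psi> x" for x
    proof (cases "\<psi> x > 0")
      case True
      then have "\<bar>q x - p x\<bar> \<le> \<epsilon>" using p(2)[of x] pos[of x] by simp
      then have "\<psi> x * \<bar>q x - p x\<bar> \<le> \<psi> x * \<epsilon>" using nn by (rule mult_left_mono)
      moreover have "u x - \<psi> x * p x = \<psi> x * (q x - p x)" by (simp add: uq right_diff_distrib)
      ultimately show ?thesis using nn[of x] by (simp add: abs_mult mult.commute)
    next
      case False
      then have "\<psi> x = 0" using nn[of x] by simp
      then show ?thesis by (simp add: uq)
    qed
    then show ?thesis using p(1) by blast
  qed
  with that C b r show ?thesis by blast
qed

text \<open>In \<open>eigenfunction_duality\<close>, twice the pairing of \<open>u\<close> and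
  \<open>v\<close> minus the squared norm of \<open>v\<close> is the squared norm of
  \<open>u\<close> minus that of \<open>u - v\<close>. The last term is made small by
  density.\<close>

lemma sph_resolvent_bound:
  fixes u :: "real^'n \<Rightarrow> real"
  assumes n: "CARD('n) \<ge> 2" and u: "C_k_on 2 UNIV u" "bounded_support u"
    and m: "\<And>i. \<bar>sphere_eigenvalue CARD('n) i - m\<bar> \<ge> d" "d > 0"
  shows "d\<^sup>2 * (LINT x|lborel. (u x)\<^sup>2) \<le> (LINT x|lborel. (sph u x - m * u x)\<^sup>2)"
proof (rule field_le_epsilon)
  fix \<delta> :: real assume "\<delta> > 0"
  have uc: "continuous_on UNIV u" using u(1) by (rule C_k_on_continuous)
  obtain \<psi> where \<psi>: "C_k_on 2 UNIV \<psi>" "bounded_support \<psi>" "\<And>i k. rot i k \<psi> = (\<lambda>x. 0)"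
    and dense: "\<And>\<epsilon>. \<epsilon> > 0 \<Longrightarrow> \<exists>p. real_polynomial_function p \<and> (\<forall>x. \<bar>u x - \<psi> x * p x\<bar> \<le> \<epsilon> * \<psi> x)"
    using polynomial_cutoff_dense[OF uc u(2)] by metis
  define K where "K = (LINT x|lborel. (\<psi> x)\<^sup>2)"
  have K: "K \<ge> 0" unfolding K_def by (rule integral_square_nonneg)
  \<comment> \<open>This gives \<open>\<epsilon> * (d\<^sup>2 * K) \<le> \<delta>\<close>; the cap 1
    yields \<open>\<epsilon>\<^sup>2 \<le> \<epsilon>\<close>, and the summand 1 keeps the
    denominator positive.\<close>
  define \<epsilon> where "\<epsilon> = min 1 (\<delta> / (d\<^sup>2 * K + 1))"
  have dK: "d\<^sup>2 * K \<ge> 0" using K by simp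
  have \<epsilon>: "0 < \<epsilon>" "\<epsilon> \<le> 1" using \<open>\<delta> > 0\<close> dK by (auto simp: \<epsilon>_def)
  have "\<epsilon> * (d\<^sup>2 * K + 1) \<le> \<delta>"
    using dK by (simp add: \<epsilon>_def pos_le_divide_eq[symmetric])
  then have eK: "\<epsilon> * (d\<^sup>2 * K) \<le> \<delta>" using \<epsilon> by (simp add: distrib_left)
  have "\<epsilon>\<^sup>2 \<le> \<epsilon>" using \<epsilon> by (simp add: power2_eq_square mult_left_le)
  then have eK2: "\<epsilon>\<^sup>2 * (d\<^sup>2 * K) \<le> \<delta>"
    using mult_right_mono[OF _ dK, of "\<epsilon>\<^sup>2" \<epsilon>] eK by linarith
  obtain p where p: "real_polynomial_function p" "\<And>x. \<bar>u x - \<psi> x * p x\<bar> \<le> \<epsilon> * \<psi> x"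
    using dense[OF \<epsilon>(1)] by blast
  obtain h N where h: "sph_eigenfunctions h" "p = (\<lambda>x. \<Sum>i\<le>N. h i x)"
    using polynomial_eigenfunctions[OF n p(1)] by blast
  define v where "v = (\<lambda>x. \<psi> x * p x)"
  have main: "2 * d\<^sup>2 * (LINT x|lborel. u x * v x)
    \<le> (LINT x|lborel. (sph u x - m * u x)\<^sup>2) + d\<^sup>2 * (LINT x|lborel. (v x)\<^sup>2)"
    using eigenfunction_duality[OF h(1) n u \<psi> m] unfolding v_def h(2) by blast
  have pc: "continuous_on UNIV p"
    using continuous_on_polymonial_function[of p UNIV] p(1) real_polynomial_function_eq by blast
  have \<psi>c: "continuous_on UNIV \<psi>" using \<psi>(1) by (rule C_k_on_continuous)
  have vc: "continuous_on UNIV v" unfolding v_def by (intro continuous_intros pc \<psi>c)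
  have vb: "bounded_support v" unfolding v_def by (intro bounded_support_mult \<psi>)
  have i: "integrable lborel (\<lambda>x. u x * u x)" "integrable lborel (\<lambda>x. u x * v x)" "integrable lborel (\<lambda>x. v x * v x)"
      "integrable lborel (\<lambda>x. \<psi> x * \<psi> x)"
    by (intro integrable_mult_bounded_support uc vc \<psi>c u vb \<psi>)+
  have eq: "(u x - v x)\<^sup>2 = u x * u x - 2 * (u x * v x) + v x * v x" for x
    by (simp add: power2_eq_square algebra_simps)
  have "(LINT x|lborel. (u x - v x)\<^sup>2) \<le> (LINT x|lborel. \<epsilon>\<^sup>2 * (\<psi> x * \<psi> x))"
  proof (rule integral_mono)
    show "integrable lborel (\<lambda>x. (u x - v x)\<^sup>2)" unfolding eq using i by simp
    show "integrable lborel (\<lambda>x. \<epsilon>\<^sup>2 * (\<psi> x * \<psi> x))" using i by simp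
    show "(u x - v x)\<^sup>2 \<le> \<epsilon>\<^sup>2 * (\<psi> x * \<psi> x)" for x
      using power_mono[OF p(2)[of x], of 2] by (simp add: v_def power2_eq_square mult_ac)
  qed
  also have "\<dots> = \<epsilon>\<^sup>2 * K" by (simp add: K_def power2_eq_square)
  finally have "(LINT x|lborel. (u x)\<^sup>2) - 2 * (LINT x|lborel. u x * v x) + (LINT x|lborel. (v x)\<^sup>2) \<le> \<epsilon>\<^sup>2 * K"
    unfolding eq using i by (simp add: power2_eq_square)
  then have "d\<^sup>2 * ((LINT x|lborel. (u x)\<^sup>2) - 2 * (LINT x|lborel. u x * v x) + (LINT x|lborel. (v x)\<^sup>2)) \<le> d\<^sup>2 * (\<epsilon>\<^sup>2 * K)"
    by (rule mult_left_mono) simp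
  then show "d\<^sup>2 * (LINT x|lborel. (u x)\<^sup>2) \<le> (LINT x|lborel. (sph u x - m * u x)\<^sup>2) + \<delta>"
    using main eK2 by (simp add: algebra_simps)
qed

text \<open>Apply the resolvent bound at the midpoint \<open>m\<close> of two consecutive
  eigenvalues, with \<open>d\<close> half their distance: no eigenvalue is closer to
  \<open>m\<close> than \<open>d\<close>. Expanding the square and using
  \<open>m\<^sup>2 - d\<^sup>2 = a * b\<close> gives the claim.\<close>

lemma sph_spectral_gap:
  fixes u :: "real^'n \<Rightarrow> real" and j :: nat
  assumes n: "CARD('n) \<ge> 2" and u: "C_k_on 2 UNIV u" "bounded_support u"
  defines "a \<equiv> sphere_eigenvalue CARD('n) j" and "b \<equiv> sphere_eigenvalue CARD('n) (Suc j)"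
  shows "(LINT x|lborel. (sph u x)\<^sup>2) - (a + b) * (LINT x|lborel. sph u x * u x)
      + a * b * (LINT x|lborel. (u x)\<^sup>2) \<ge> 0"
proof -
  define m d where "m = (a + b) / 2" and "d = (b - a) / 2"
  have mono: "sphere_eigenvalue CARD('n) i \<le> sphere_eigenvalue CARD('n) k" if "i \<le> k" for i k
    using sphere_eigenvalue_strict_mono[OF n, of i k] that by (cases "i = k") auto
  have ab: "a < b" unfolding a_def b_def by (rule sphere_eigenvalue_strict_mono[OF n]) simp
  have "\<bar>sphere_eigenvalue CARD('n) i - m\<bar> \<ge> d" for i
  proof (cases "i \<le> j")
    case True
    then have "sphere_eigenvalue CARD('n) i \<le> a" unfolding a_def by (rule mono)
    then have "d \<le> - (sphere_eigenvalue CARD('n) i - m)" by (simp add: m_def d_def field_simps)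
    then show ?thesis using abs_ge_minus_self order_trans by blast
  next
    case False
    then have "b \<le> sphere_eigenvalue CARD('n) i" unfolding b_def by (intro mono) simp
    then have "d \<le> sphere_eigenvalue CARD('n) i - m" by (simp add: m_def d_def field_simps)
    then show ?thesis using abs_ge_self order_trans by blast
  qed
  moreover have "d > 0" using ab by (simp add: d_def)
  ultimately have *: "d\<^sup>2 * (LINT x|lborel. (u x)\<^sup>2) \<le> (LINT x|lborel. (sph u x - m * u x)\<^sup>2)"
    by (intro sph_resolvent_bound n u)
  have uc: "continuous_on UNIV u" "continuous_on UNIV (sph u)"
    using u C_k_on_continuous C_1_of_C_2(4) by blast+
  have i: "integrable lborel (\<lambda>x. u x * u x)" "integrable lborel (\<lambda>x. sph u x * u x)" "integrable lborel (\<lambda>x. sph u x * sph u x)"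
    by (intro integrable_mult_bounded_support uc u bounded_support_sph)+
  have eq: "(sph u x - m * u x)\<^sup>2 = sph u x * sph u x - 2 * m * (sph u x * u x) + m\<^sup>2 * (u x * u x)" for x
    by (simp add: power2_eq_square algebra_simps)
  have "(LINT x|lborel. (sph u x - m * u x)\<^sup>2) = (LINT x|lborel. (sph u x)\<^sup>2)
      - 2 * m * (LINT x|lborel. sph u x * u x) + m\<^sup>2 * (LINT x|lborel. (u x)\<^sup>2)"
    unfolding eq using i by (simp add: power2_eq_square[symmetric])
  moreover have "m\<^sup>2 - d\<^sup>2 = a * b" "2 * m = a + b"
    by (simp_all add: m_def d_def power2_eq_square field_simps)
  ultimately show ?thesis using * by (simp add: left_diff_distrib[symmetric] flip: \<open>m\<^sup>2 - d\<^sup>2 = a * b\<close>) (simp add: algebra_simps)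
qed

lemma integral_sph_nonneg:
  assumes u: "C_k_on 2 UNIV u" "bounded_support u"
  shows "(LINT x|lborel. sph u x * u x) \<ge> 0"
  unfolding integral_sph_mult(1)[OF u(1,1,2)]
  by (intro divide_nonneg_pos sum_nonneg Bochner_Integration.integral_nonneg) auto

text \<open>Subtracting the gap inequality leaves an expression affine in \<open>Y / X\<close>,
  nonnegative at the two eigenvalues that enclose this quotient.\<close>

lemma sph_quadratic_nonneg:
  fixes u :: "real^'n \<Rightarrow> real"
  assumes n: "CARD('n) \<ge> 2" and u: "C_k_on 2 UNIV u" "bounded_support u"
    and p: "\<And>j. (sphere_eigenvalue CARD('n) j)\<^sup>2 + \<beta> * sphere_eigenvalue CARD('n) j + \<kappa> \<ge> 0"
  shows "(LINT x|lborel. (sph u x)\<^sup>2) + \<beta> * (LINT x|lborel. sph u x * u x)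
      + \<kappa> * (LINT x|lborel. (u x)\<^sup>2) \<ge> 0"
proof -
  let ?l = "sphere_eigenvalue CARD('n)"
  define X Y Z where "X = (LINT x|lborel. (u x)\<^sup>2)" and "Y = (LINT x|lborel. sph u x * u x)"
    and "Z = (LINT x|lborel. (sph u x)\<^sup>2)"
  have gap: "Z - (?l j + ?l (Suc j)) * Y + ?l j * ?l (Suc j) * X \<ge> 0" for j
    unfolding X_def Y_def Z_def by (rule sph_spectral_gap[OF n u])
  have X: "X \<ge> 0" unfolding X_def by (rule integral_square_nonneg)
  have Y: "Y \<ge> 0"
    unfolding Y_def by (rule integral_sph_nonneg[OF u])
  have lj: "?l j \<ge> real j" for j
    using n mult_left_mono[of 1 "real j + real CARD('n) - 2" "real j"]
    by (cases j) (auto simp: sphere_eigenvalue_def)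
  show ?thesis
  proof (cases "X = 0")
    case True
    \<comment> \<open>When \<open>u\<close> has norm zero there is no quotient to locate. A large
      \<open>j\<close> makes the coefficient of \<open>Y\<close> nonnegative.\<close>
    obtain j :: nat where j: "real j \<ge> \<bar>\<beta>\<bar>" using real_arch_simple by blast
    have "?l j + ?l (Suc j) + \<beta> \<ge> 0" using lj[of j] lj[of "Suc j"] j by simp
    then have "(?l j + ?l (Suc j) + \<beta>) * Y \<ge> 0" using Y by simp
    then show ?thesis using gap[of j] True
      by (simp add: X_def[symmetric] Y_def[symmetric] Z_def[symmetric] distrib_right)
  next
    case False
    then have "X > 0" using X by simp
    obtain k :: nat where k: "real k \<ge> Y / X" using real_arch_simple by blast
    have ex: "\<exists>k. Y \<le> ?l (Suc k) * X"
    proof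
      have "Y / X \<le> ?l (Suc k)" using k lj[of "Suc k"] by simp
      then show "Y \<le> ?l (Suc k) * X" using \<open>X > 0\<close> by (simp add: pos_divide_le_eq)
    qed
    \<comment> \<open>Minimality places \<open>Y / X\<close> between the \<open>j\<close>-th and the
      next eigenvalue; for \<open>j = 0\<close> the lower bound is \<open>Y \<ge> 0\<close>.\<close>
    define j where "j = (LEAST k. Y \<le> ?l (Suc k) * X)"
    have up: "Y \<le> ?l (Suc j) * X" unfolding j_def by (rule LeastI_ex[OF ex])
    have lo: "?l j * X \<le> Y"
    proof (cases j)
      case 0
      then show ?thesis using Y by (simp add: sphere_eigenvalue_def)
    next
      case (Suc i)
      then have "\<not> Y \<le> ?l (Suc i) * X" using not_less_Least[of i "\<lambda>k. Y \<le> ?l (Suc k) * X"] by (simp add: j_def)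
      then show ?thesis using Suc by simp
    qed
    define a b where "a = ?l j" and "b = ?l (Suc j)"
    have pa: "0 \<le> (a\<^sup>2 + \<beta> * a + \<kappa>) * X" and pb: "0 \<le> (b\<^sup>2 + \<beta> * b + \<kappa>) * X"
      using p X unfolding a_def b_def by simp_all
    \<comment> \<open>The sign of the slope decides at which endpoint the affine function is
      compared.\<close>
    have "0 \<le> (a + b + \<beta>) * Y + (\<kappa> - a * b) * X"
    proof (cases "a + b + \<beta> \<ge> 0")
      case True
      then have "(a + b + \<beta>) * (a * X) \<le> (a + b + \<beta>) * Y"
        using lo unfolding a_def[symmetric] by (intro mult_left_mono)
      then show ?thesis using pa by (simp add: power2_eq_square algebra_simps)
    next
      case False
      then have "(a + b + \<beta>) * (b * X) \<le> (a + b + \<beta>) * Y"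
        using up unfolding b_def[symmetric] by (intro mult_left_mono_neg) auto
      then show ?thesis using pb by (simp add: power2_eq_square algebra_simps)
    qed
    then show ?thesis using gap[of j]
      unfolding X_def[symmetric] Y_def[symmetric] Z_def[symmetric] a_def[symmetric] b_def[symmetric]
      by (simp add: algebra_simps)
  qed
qed

section \<open>The inequality after removal of the weight\<close>

lemma euler_sum:
  assumes "finite I" "\<And>j. j \<in> I \<Longrightarrow> C_k_on 1 UNIV (f j)"
  shows "euler (\<lambda>x. \<Sum>j\<in>I. f j x) = (\<lambda>x. \<Sum>j\<in>I. euler (f j) x)"
proof
  fix x
  show "euler (\<lambda>x. \<Sum>j\<in>I. f j x) x = (\<Sum>j\<in>I. euler (f j) x)"
    unfolding euler_def by (simp add: partial_sum[OF assms] sum_distrib_left) (rule sum.swap)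
qed

text \<open>Each rotation commutes with \<open>euler\<close>. The commutation is used for
  \<open>u\<close> and for \<open>rot i k u\<close>, and the latter must again be of class
  C^2.\<close>

lemma sph_euler_commute:
  assumes u: "C_k_on 3 UNIV u"
  shows "sph (euler u) = euler (sph u)"
proof -
  have u2: "C_k_on 2 UNIV u" by (rule C_k_on_le[OF u]) simp
  have r2: "C_k_on 2 UNIV (rot i k u)" for i k
    using C_k_on_rot[of 2 u i k] u by (simp only: numeral_3_eq_3 numeral_2_eq_2)
  have r1: "C_k_on 1 UNIV (rot i k (rot i k u))" for i k
    by (rule C_1_of_C_2(2)[OF r2])
  have s: "C_k_on 1 UNIV (\<lambda>x. \<Sum>k\<in>UNIV. rot i k (rot i k u) x)" for i
    by (intro C_k_on_sum r1) auto
  have ss: "C_k_on 1 UNIV (\<lambda>x. \<Sum>i\<in>UNIV. \<Sum>k\<in>UNIV. rot i k (rot i k u) x)"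
    by (intro C_k_on_sum s) auto
  have "sph u = (\<lambda>x. (- 1 / 2) * (\<Sum>i\<in>UNIV. \<Sum>k\<in>UNIV. rot i k (rot i k u) x))"
    by (simp add: sph_def fun_eq_iff)
  then have "euler (sph u) = (\<lambda>x. (- 1 / 2) * (\<Sum>i\<in>UNIV. \<Sum>k\<in>UNIV. euler (rot i k (rot i k u)) x))"
    by (simp only: euler_cmult[OF ss] euler_sum[OF finite s] euler_sum[OF finite r1])
  then show ?thesis
    by (simp add: sph_def fun_eq_iff rot_euler_commute[OF u2] rot_euler_commute[OF r2])
qed

text \<open>The shift \<open>n/2\<close> makes the Euler operator antisymmetric in \<open>L\<^sup>2\<close> with respect to Lebesgue measure.\<close>

definition dil :: "(real^'n \<Rightarrow> real) \<Rightarrow> real^'n \<Rightarrow> real" where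
  "dil f x = euler f x + real CARD('n) / 2 * f x"

lemma integral_dil_mult:
  fixes f g :: "real^'n \<Rightarrow> real"
  assumes f: "C_k_on 1 UNIV f" and g: "C_k_on 1 UNIV g" and bs: "bounded_support f"
  shows "(LINT x|lborel. dil f x * g x) = - (LINT x|lborel. f x * dil g x)"
proof -
  have c: "continuous_on UNIV f" "continuous_on UNIV g" "continuous_on UNIV (euler f)" "continuous_on UNIV (euler g)"
    by (intro continuous_of_C_1 f g)+
  have i: "integrable lborel (\<lambda>x. euler f x * g x)" "integrable lborel (\<lambda>x. f x * euler g x)" "integrable lborel (\<lambda>x. f x * g x)"
    by (intro integrable_mult_bounded_support c bs bounded_support_euler)+
  have "(LINT x|lborel. dil f x * g x) = (LINT x|lborel. euler f x * g x + real CARD('n) / 2 * (f x * g x))"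
    by (simp add: dil_def distrib_right mult.assoc)
  also have "\<dots> = - ((LINT x|lborel. f x * euler g x) + real CARD('n) / 2 * (LINT x|lborel. f x * g x))"
    using i integral_euler_mult[OF f g bs] by simp
  also have "\<dots> = - (LINT x|lborel. f x * euler g x + real CARD('n) / 2 * (f x * g x))"
    using i by simp
  finally show ?thesis by (simp add: dil_def distrib_left mult.left_commute)
qed

lemma C_k_on_dil:
  assumes "C_k_on (Suc k) UNIV f"
  shows "C_k_on k UNIV (dil f)"
  unfolding dil_def[abs_def]
  by (intro C_k_on_add C_k_on_mult C_k_on_const open_UNIV C_k_on_euler[OF assms] C_k_on_Suc_imp[OF assms])

lemma bounded_support_dil: "bounded_support f \<Longrightarrow> bounded_support (dil f)"
  unfolding dil_def[abs_def]
  by (intro bounded_support_add bounded_support_mult bounded_support_euler)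

lemma sph_dil_commute:
  assumes u: "C_k_on 3 UNIV u"
  shows "sph (dil u) = dil (sph u)"
proof -
  have u2: "C_k_on 2 UNIV u" "C_k_on 2 UNIV (euler u)"
    using C_k_on_le[OF u] C_k_on_euler[of 2 u] u by (simp_all only: numeral_3_eq_3 numeral_2_eq_2)
  show ?thesis
    unfolding dil_def[abs_def]
    by (simp only: sph_add[OF u2(2) C_k_on_mult[OF open_UNIV C_k_on_const u2(1)]] sph_cmult[OF u2(1)]
        sph_euler_commute[OF u])
qed

text \<open>Expand the square. Antisymmetry of \<open>dil\<close> kills the pairings of
  \<open>Q\<close> with \<open>P\<close>, \<open>u\<close> and \<open>S\<close>, and turns that of
  \<open>P\<close> with \<open>u\<close> into minus the squared norm of \<open>Q\<close>. The
  squared norm of \<open>P\<close> and the nonnegative contribution of \<open>P\<close> with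
  \<open>S\<close> are dropped.\<close>

lemma rellich_lower_bound:
  fixes u :: "real^'n \<Rightarrow> real" and b c :: real
  assumes C: "\<And>k. C_k_on k UNIV u" and bs: "bounded_support u"
  shows "(LINT x|lborel. (dil (dil u) x + c * dil u x - b * u x - sph u x)\<^sup>2)
    \<ge> (c\<^sup>2 + 2 * b) * (LINT x|lborel. (dil u x)\<^sup>2)
      + (LINT x|lborel. (sph u x)\<^sup>2) + 2 * b * (LINT x|lborel. sph u x * u x) + b\<^sup>2 * (LINT x|lborel. (u x)\<^sup>2)"
proof -
  define Q P S where "Q = dil u" and "P = dil Q" and "S = sph u"
  have CQ: "C_k_on k UNIV Q" and CP: "C_k_on k UNIV P" and CS: "C_k_on k UNIV S" for k
    unfolding P_def Q_def S_def by (intro C_k_on_dil C_k_on_sph C)+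
  have b': "bounded_support Q" "bounded_support P" "bounded_support S"
    unfolding P_def Q_def S_def by (intro bounded_support_dil bounded_support_sph bs)+
  have c': "continuous_on UNIV u" "continuous_on UNIV Q" "continuous_on UNIV P" "continuous_on UNIV S"
    using C_k_on_continuous[OF C] C_k_on_continuous[OF CQ] C_k_on_continuous[OF CP] C_k_on_continuous[OF CS] by auto
  note int = integrable_mult_bounded_support
  have i: "integrable lborel (\<lambda>x. P x * P x)" "integrable lborel (\<lambda>x. Q x * Q x)" "integrable lborel (\<lambda>x. S x * S x)"
     "integrable lborel (\<lambda>x. u x * u x)" "integrable lborel (\<lambda>x. P x * Q x)" "integrable lborel (\<lambda>x. P x * u x)"
     "integrable lborel (\<lambda>x. P x * S x)" "integrable lborel (\<lambda>x. Q x * u x)" "integrable lborel (\<lambda>x. Q x * S x)"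
     "integrable lborel (\<lambda>x. S x * u x)"
    by (intro int c' b' bs)+
  have PQ: "(LINT x|lborel. P x * Q x) = 0"
    using integral_dil_mult[OF CQ CQ b'(1)] by (simp add: P_def mult.commute)
  have Qu: "(LINT x|lborel. Q x * u x) = 0"
    using integral_dil_mult[OF C C bs] by (simp add: Q_def mult.commute)
  have dS: "dil S = sph Q" by (simp only: S_def Q_def sph_dil_commute[OF C])
  \<comment> \<open>Moving \<open>dil\<close> and then \<open>sph\<close> to the other factor
    reproduces the same integral with the opposite sign.\<close>
  have QS: "(LINT x|lborel. Q x * S x) = 0"
  proof -
    have "(LINT x|lborel. Q x * S x) = - (LINT x|lborel. u x * sph Q x)"
      unfolding dS[symmetric] unfolding Q_def by (rule integral_dil_mult[OF C CS bs])
    also have "(LINT x|lborel. u x * sph Q x) = (LINT x|lborel. Q x * S x)"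
      using integral_sph_mult(2)[OF C CQ bs] by (simp add: S_def mult.commute)
    finally show ?thesis by simp
  qed
  have Pu: "(LINT x|lborel. P x * u x) = - (LINT x|lborel. Q x * Q x)"
    using integral_dil_mult[OF CQ C b'(1)] by (simp add: P_def Q_def)
  \<comment> \<open>The integral equals minus the Dirichlet form of \<open>sph\<close> at
    \<open>Q\<close>.\<close>
  have PS: "(LINT x|lborel. P x * S x) \<le> 0"
    using integral_dil_mult[OF CQ CS b'(1)] integral_sph_nonneg[OF CQ b'(1)]
    by (simp add: P_def[symmetric] dS mult.commute)
  have "(LINT x|lborel. (P x + c * Q x - b * u x - S x)\<^sup>2)
    = (LINT x|lborel. P x * P x + c\<^sup>2 * (Q x * Q x) + b\<^sup>2 * (u x * u x) + S x * S x + 2 * c * (P x * Q x)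
       - 2 * b * (P x * u x) - 2 * (P x * S x) - 2 * b * c * (Q x * u x) - 2 * c * (Q x * S x) + 2 * b * (S x * u x))"
    by (rule arg_cong[of _ _ "integral\<^sup>L lborel"]) (simp add: fun_eq_iff power2_eq_square algebra_simps)
  also have "\<dots> = (LINT x|lborel. P x * P x) + c\<^sup>2 * (LINT x|lborel. Q x * Q x) + b\<^sup>2 * (LINT x|lborel. u x * u x)
      + (LINT x|lborel. S x * S x) + 2 * c * (LINT x|lborel. P x * Q x)
       - 2 * b * (LINT x|lborel. P x * u x) - 2 * (LINT x|lborel. P x * S x) - 2 * b * c * (LINT x|lborel. Q x * u x)
       - 2 * c * (LINT x|lborel. Q x * S x) + 2 * b * (LINT x|lborel. S x * u x)"
    using i by simp
  finally have "(LINT x|lborel. (P x + c * Q x - b * u x - S x)\<^sup>2) = (LINT x|lborel. P x * P x)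
      + c\<^sup>2 * (LINT x|lborel. Q x * Q x) + b\<^sup>2 * (LINT x|lborel. u x * u x)
      + (LINT x|lborel. S x * S x) + 2 * b * (LINT x|lborel. Q x * Q x) - 2 * (LINT x|lborel. P x * S x)
      + 2 * b * (LINT x|lborel. S x * u x)"
    by (simp add: PQ Qu QS Pu)
  moreover have "(LINT x|lborel. P x * P x) \<ge> 0"
    using integral_square_nonneg[of P] by (simp add: power2_eq_square)
  ultimately show ?thesis using PS
    unfolding P_def Q_def S_def power2_eq_square[of "dil _ _"] power2_eq_square[of "sph _ _"] power2_eq_square[of "u _"]
      distrib_right by linarith
qed

text \<open>For \<open>j \<ge> 1\<close> the first bound is
  \<open>A \<le> alpha n \<gamma> j\<close> with the positive denominator cleared; the case
  \<open>j = 0\<close> and the second bound use the value of \<open>alpha\<close> at 0.\<close>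

lemma A_const_bounds:
  fixes n :: nat and \<gamma> :: real
  assumes n: "n \<ge> 2"
  defines "s \<equiv> (real n + \<gamma> - 4) / 2" and "b \<equiv> (real n + \<gamma> - 4) * (real n - \<gamma>) / 4"
  shows "(b + sphere_eigenvalue n j)\<^sup>2 - A_const n \<gamma> * (s\<^sup>2 + sphere_eigenvalue n j) \<ge> 0" (is ?P)
    and "(2 - \<gamma>)\<^sup>2 + 2 * b - A_const n \<gamma> \<ge> 0" (is ?Q)
proof -
  note A = A_const_is_minimum(2)[OF n, of \<gamma>]
  have A0: "A_const n \<gamma> \<le> (real n - \<gamma>)\<^sup>2 / 4" using A[of 0] by (simp add: alpha_def)
  show ?P
  proof (cases "j = 0")
    case True
    have "A_const n \<gamma> * s\<^sup>2 \<le> (real n - \<gamma>)\<^sup>2 / 4 * s\<^sup>2" using A0 by (rule mult_right_mono) simp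
    \<comment> \<open>\<open>b\<close> is \<open>s\<close> times \<open>(n - \<gamma>) / 2\<close>,
      so the bound holds without dividing by \<open>s\<^sup>2\<close>, which may be zero.\<close>
    also have "\<dots> = b\<^sup>2" by (simp add: s_def b_def power_mult_distrib power_divide)
    finally show ?thesis using True by (simp add: sphere_eigenvalue_def)
  next
    case False
    have "sphere_eigenvalue n j > 0"
      using sphere_eigenvalue_strict_mono[OF n, of 0 j] False by (simp add: sphere_eigenvalue_def)
    then have pos: "s\<^sup>2 + sphere_eigenvalue n j > 0" by (simp add: add_nonneg_pos)
    have "A_const n \<gamma> \<le> (b + sphere_eigenvalue n j)\<^sup>2 / (s\<^sup>2 + sphere_eigenvalue n j)"
      using A[of j] False by (simp add: alpha_def b_def s_def power_divide)
    then show ?thesis using pos by (simp add: pos_le_divide_eq)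
  qed
  have "(2 - \<gamma>)\<^sup>2 + 2 * b - (real n - \<gamma>)\<^sup>2 / 4 = s\<^sup>2"
    by (simp add: s_def b_def power2_eq_square field_simps)
  then show ?Q using A0 zero_le_power2[of s] by linarith
qed

text \<open>The integral on the right is \<open>V + s\<^sup>2 * X + Y\<close>. Subtracting
  \<open>A\<close> times it from \<open>rellich_lower_bound\<close> leaves a nonnegative multiple of
  \<open>V\<close> and a quadratic expression in \<open>sph\<close> that is nonnegative at every
  eigenvalue.\<close>

lemma dil_rellich_hardy:
  fixes u :: "real^'n \<Rightarrow> real" and \<gamma> :: real
  assumes n: "CARD('n) \<ge> 2" and C: "\<And>k. C_k_on k UNIV u" and bs: "bounded_support u"
  defines "s \<equiv> (real CARD('n) + \<gamma> - 4) / 2" and "b \<equiv> (real CARD('n) + \<gamma> - 4) * (real CARD('n) - \<gamma>) / 4"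
  shows "(LINT x|lborel. (dil (dil u) x + (2 - \<gamma>) * dil u x - b * u x - sph u x)\<^sup>2)
    \<ge> A_const CARD('n) \<gamma> * (LINT x|lborel. (dil u x - s * u x)\<^sup>2 + (\<Sum>i\<in>UNIV. \<Sum>k\<in>UNIV. (rot i k u x)\<^sup>2) / 2)"
proof -
  let ?A = "A_const CARD('n) \<gamma>"
  define X Y Z V where "X = (LINT x|lborel. (u x)\<^sup>2)" and "Y = (LINT x|lborel. sph u x * u x)"
    and "Z = (LINT x|lborel. (sph u x)\<^sup>2)" and "V = (LINT x|lborel. (dil u x)\<^sup>2)"
  have c': "continuous_on UNIV u" "continuous_on UNIV (dil u)" "continuous_on UNIV (rot i k u)" for i k
    using C_k_on_continuous[OF C] C_k_on_continuous[OF C_k_on_dil[OF C]] C_k_on_continuous[OF C_k_on_rot[OF C]] by auto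
  have i: "integrable lborel (\<lambda>x. dil u x * dil u x)" "integrable lborel (\<lambda>x. dil u x * u x)" "integrable lborel (\<lambda>x. u x * u x)"
     "integrable lborel (\<lambda>x. rot i k u x * rot i k u x)" for i k
    by (intro integrable_mult_bounded_support c' bs bounded_support_dil bounded_support_rot)+
  have "(LINT x|lborel. (dil u x - s * u x)\<^sup>2 + (\<Sum>i\<in>UNIV. \<Sum>k\<in>UNIV. (rot i k u x)\<^sup>2) / 2)
    = (LINT x|lborel. (dil u x * dil u x - 2 * s * (dil u x * u x) + s\<^sup>2 * (u x * u x))
        + (\<Sum>i\<in>UNIV. \<Sum>k\<in>UNIV. rot i k u x * rot i k u x) / 2)"
    by (rule arg_cong[of _ _ "integral\<^sup>L lborel"]) (simp add: fun_eq_iff power2_eq_square algebra_simps)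
  also have "\<dots> = (LINT x|lborel. dil u x * dil u x) - 2 * s * (LINT x|lborel. dil u x * u x) + s\<^sup>2 * (LINT x|lborel. u x * u x)
        + (\<Sum>i\<in>UNIV. \<Sum>k\<in>UNIV. LINT x|lborel. rot i k u x * rot i k u x) / 2"
    using i by simp
  also have "(LINT x|lborel. dil u x * u x) = 0"
    using integral_dil_mult[OF C C bs] by (simp add: mult.commute)
  also have "(\<Sum>i\<in>UNIV. \<Sum>k\<in>UNIV. LINT x|lborel. rot i k u x * rot i k u x) / 2 = Y"
    unfolding Y_def by (rule integral_sph_mult(1)[OF C C bs, symmetric])
  finally have rhs: "(LINT x|lborel. (dil u x - s * u x)\<^sup>2 + (\<Sum>i\<in>UNIV. \<Sum>k\<in>UNIV. (rot i k u x)\<^sup>2) / 2)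
      = V + s\<^sup>2 * X + Y"
    by (simp add: V_def X_def power2_eq_square)
  have "0 \<le> (sphere_eigenvalue CARD('n) j)\<^sup>2 + (2 * b - ?A) * sphere_eigenvalue CARD('n) j + (b\<^sup>2 - ?A * s\<^sup>2)" for j
    using A_const_bounds(1)[OF n, of \<gamma> j] unfolding b_def[symmetric] s_def[symmetric]
    by (simp add: power2_eq_square algebra_simps)
  from sph_quadratic_nonneg[OF n C bs this]
  have q: "0 \<le> Z + (2 * b - ?A) * Y + (b\<^sup>2 - ?A * s\<^sup>2) * X" unfolding X_def Y_def Z_def .
  have "V \<ge> 0" unfolding V_def by (rule integral_square_nonneg)
  then have "0 \<le> ((2 - \<gamma>)\<^sup>2 + 2 * b - ?A) * V"
    using A_const_bounds(2)[OF n, of \<gamma>] unfolding b_def[symmetric] by simp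
  with q have "?A * (V + s\<^sup>2 * X + Y) \<le> ((2 - \<gamma>)\<^sup>2 + 2 * b) * V + Z + 2 * b * Y + b\<^sup>2 * X"
    by (simp add: algebra_simps)
  also have "\<dots> \<le> (LINT x|lborel. (dil (dil u) x + (2 - \<gamma>) * dil u x - b * u x - sph u x)\<^sup>2)"
    using rellich_lower_bound[OF C bs, of "2 - \<gamma>" b] unfolding V_def X_def Y_def Z_def .
  finally show ?thesis unfolding rhs .
qed

section \<open>Radial weights and the theorem\<close>

text \<open>At the origin \<open>powr\<close> has base 0 and value 0, so the product is 0 there for
  every exponent.\<close>

definition radial_mult :: "real \<Rightarrow> (real^'n \<Rightarrow> real) \<Rightarrow> real^'n \<Rightarrow> real" where
  "radial_mult \<kappa> f x = norm x powr \<kappa> * f x"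

lemma partial_norm_powr:
  assumes "x \<noteq> 0"
  shows "partial i (\<lambda>x. norm x powr \<kappa>) x = \<kappa> * norm x powr (\<kappa> - 2) * x $ i"
    and "\<exists>g'. ((\<lambda>x. norm x powr \<kappa>) has_derivative g') (at x)"
proof -
  have d: "((\<lambda>x. norm x powr \<kappa>) has_derivative (\<lambda>v. (v \<bullet> sgn x) * (\<kappa> * norm x powr (\<kappa> - 1)))) (at x)"
    by (rule DERIV_compose_FDERIV[OF has_real_derivative_powr has_derivative_norm]) (use assms in simp_all)
  then show "\<exists>g'. ((\<lambda>x. norm x powr \<kappa>) has_derivative g') (at x)" by blast
  have e: "norm x powr (\<kappa> - 1) = norm x powr (\<kappa> - 2) * norm x"
    using assms powr_add[of "norm x" "\<kappa> - 2" 1] by simp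
  have "axis i 1 \<bullet> sgn x = x $ i / norm x"
    by (simp add: inner_axis' sgn_div_norm divide_inverse mult.commute)
  then show "partial i (\<lambda>x. norm x powr \<kappa>) x = \<kappa> * norm x powr (\<kappa> - 2) * x $ i"
    using partial_eqI[OF d, of i] assms by (simp add: e)
qed

lemma partial_radial_mult:
  assumes f: "C_k_on 1 UNIV f" and x: "x \<noteq> 0"
  shows "partial i (radial_mult \<kappa> f) x = norm x powr \<kappa> * partial i f x + \<kappa> * norm x powr (\<kappa> - 2) * x $ i * f x"
proof -
  obtain g' where g: "((\<lambda>x. norm x powr \<kappa>) has_derivative g') (at x)"
    using partial_norm_powr(2)[OF x] by blast
  show ?thesis
    unfolding radial_mult_def[abs_def] partial_eqI[OF has_derivative_mult[OF g C_1_has_derivative[OF f]]]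
    using partial_eqI[OF g, of i] partial_norm_powr(1)[OF x] by (simp add: partial_def)
qed

lemma rot_radial_mult:
  assumes f: "C_k_on 1 UNIV f"
  shows "rot i k (radial_mult \<kappa> f) = radial_mult \<kappa> (rot i k f)"
proof
  fix x
  show "rot i k (radial_mult \<kappa> f) x = radial_mult \<kappa> (rot i k f) x"
    by (cases "x = 0")
      (simp_all add: rot_def partial_radial_mult[OF f], simp_all add: radial_mult_def rot_def algebra_simps)
qed

text \<open>A power of the norm is homogeneous of degree \<open>\<kappa>\<close>, so conjugation
  shifts the Euler operator by \<open>\<kappa>\<close>. At the origin both sides vanish.\<close>

lemma euler_radial_mult:
  assumes f: "C_k_on 1 UNIV f"
  shows "euler (radial_mult \<kappa> f) = radial_mult \<kappa> (\<lambda>x. euler f x + \<kappa> * f x)"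
proof
  fix x :: "real^'a"
  show "euler (radial_mult \<kappa> f) x = radial_mult \<kappa> (\<lambda>x. euler f x + \<kappa> * f x) x"
  proof (cases "x = 0")
    case False
    have "norm x powr \<kappa> = norm x powr (\<kappa> - 2 + 2)" by simp
    also have "\<dots> = norm x powr (\<kappa> - 2) * (norm x)\<^sup>2"
      using False by (subst powr_add) simp
    also have "(norm x)\<^sup>2 = (\<Sum>i\<in>UNIV. x $ i * x $ i)"
      by (simp add: norm_vec_def L2_set_def sum_nonneg power2_eq_square[symmetric])
    finally have n: "norm x powr \<kappa> = norm x powr (\<kappa> - 2) * (\<Sum>i\<in>UNIV. x $ i * x $ i)" .
    have "euler (radial_mult \<kappa> f) x = (\<Sum>i\<in>UNIV. norm x powr \<kappa> * (x $ i * partial i f x) + \<kappa> * f x * (norm x powr (\<kappa> - 2) * (x $ i * x $ i)))"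
      unfolding euler_def by (simp add: partial_radial_mult[OF f False] algebra_simps)
    also have "\<dots> = norm x powr \<kappa> * euler f x + \<kappa> * f x * norm x powr \<kappa>"
      unfolding sum.distrib sum_distrib_left[symmetric] euler_def n[symmetric] ..
    finally show ?thesis by (simp add: radial_mult_def algebra_simps)
  qed (simp add: euler_def radial_mult_def)
qed

lemma sph_radial_powr_mult:
  assumes f: "C_k_on 2 UNIV f"
  shows "sph (radial_mult \<kappa> f) = radial_mult \<kappa> (sph f)"
  unfolding sph_def[abs_def] rot_radial_mult[OF C_k_on_1_of_2[OF f]] rot_radial_mult[OF C_1_of_C_2(2)[OF f]]
  by (simp add: radial_mult_def[abs_def] sum_distrib_left)

text \<open>Away from 0 the weight is a real power of the positive polynomial
  \<open>(norm x)\<^sup>2\<close>; near 0 the product is identically zero. The two open sets cover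
  the space.\<close>

lemma C_k_on_radial_mult:
  fixes f :: "real^'n \<Rightarrow> real"
  assumes f: "C_k_on k UNIV f" and a: "a > 0" "\<And>x. norm x < a \<Longrightarrow> f x = 0"
  shows "C_k_on k UNIV (radial_mult \<kappa> f)"
proof -
  have S: "open (UNIV - {0::real^'n})" by auto
  have T: "open {x::real^'n. norm x < a}" by (intro open_Collect_less continuous_intros)
  have "C_k_on k (UNIV - {0}) (\<lambda>x::real^'n. ((norm x)\<^sup>2) powr (\<kappa> / 2) * f x)"
  proof (intro C_k_on_mult C_k_on_powr S)
    have *: "C_k_on k S f" if "C_k_on k UNIV f" for S :: "(real^'n) set" and f :: "real^'n \<Rightarrow> real"
      using that by (induction k arbitrary: f) (auto intro: continuous_on_subset)
    show "C_k_on k (UNIV - {0}) (\<lambda>x::real^'n. (norm x)\<^sup>2)" "C_k_on k (UNIV - {0}) f"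
      by (rule *[OF C_k_on_hom_poly[OF hom_poly_norm_power2]] *[OF f])+
  qed auto
  moreover have "((norm x)\<^sup>2) powr (\<kappa> / 2) * f x = radial_mult \<kappa> f x" if "x \<in> UNIV - {0}" for x
    using that by (simp add: radial_mult_def powr_powr flip: powr_numeral)
  ultimately have 1: "C_k_on k (UNIV - {0}) (radial_mult \<kappa> f)"
    by (rule C_k_on_cong[OF S, rotated])
  have 2: "C_k_on k {x. norm x < a} (radial_mult \<kappa> f)"
    by (rule C_k_on_cong[OF T _ C_k_on_const[of k _ 0]]) (simp add: radial_mult_def a)
  have "UNIV - {0} \<union> {x. norm x < a} = (UNIV :: (real^'n) set)" using a(1) by auto
  then show ?thesis using C_k_on_Un[OF S T 1 2] by simp
qed

text \<open>On functions carrying the weight, \<open>dil\<close> acts as \<open>euler + s\<close>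
  with \<open>s = (n + \<gamma> - 4) / 2\<close>. The remaining constants are those for which
  \<open>(euler + s)\<^sup>2 + (2 - \<gamma>) * (euler + s)\<close> minus the constant is the radial
  part of \<open>laplacian_split\<close>.\<close>

lemma weighted_laplacian_eq:
  fixes f :: "real^'n \<Rightarrow> real" and \<gamma> :: real
  assumes C: "C_k_on 2 UNIV f"
  defines "u \<equiv> radial_mult ((\<gamma> - 4) / 2) f" and "n \<equiv> real CARD('n)"
  shows "norm x powr \<gamma> * (\<Sum>i\<in>UNIV. partial i (partial i f) x)\<^sup>2
    = (dil (dil u) x + (2 - \<gamma>) * dil u x - (n + \<gamma> - 4) * (n - \<gamma>) / 4 * u x - sph u x)\<^sup>2"
proof -
  define \<kappa> where "\<kappa> = (\<gamma> - 4) / 2"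
  define s where "s = (n + \<gamma> - 4) / 2"
  define L where "L = (\<Sum>i\<in>UNIV. partial i (partial i f) x)"
  have C1: "C_k_on 1 UNIV f" using C by (rule C_k_on_1_of_2)
  define g where "g = (\<lambda>x. euler f x + s * f x)"
  have Cg: "C_k_on 1 UNIV g"
    unfolding g_def by (intro C_k_on_add C_k_on_mult C_k_on_const open_UNIV C1 C_1_of_C_2(3)[OF C])
  have ns: "\<kappa> + n / 2 = s" by (simp add: \<kappa>_def s_def field_simps)
  have dil: "dil (radial_mult \<kappa> h) = radial_mult \<kappa> (\<lambda>x. euler h x + s * h x)" if "C_k_on 1 UNIV h" for h :: "real^'n \<Rightarrow> real"
    unfolding dil_def[abs_def] euler_radial_mult[OF that] n_def[symmetric]
    unfolding ns[symmetric] by (simp add: radial_mult_def[abs_def] algebra_simps)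
  have du: "dil u = radial_mult \<kappa> g"
    unfolding u_def \<kappa>_def[symmetric] dil[OF C1] g_def ..
  have eg: "euler g = (\<lambda>x. euler (euler f) x + s * euler f x)"
    unfolding g_def
    by (simp only: euler_add[OF C_1_of_C_2(3)[OF C] C_k_on_mult[OF open_UNIV C_k_on_const C1]] euler_cmult[OF C1])
  have "dil (dil u) x + (2 - \<gamma>) * dil u x - (n + \<gamma> - 4) * (n - \<gamma>) / 4 * u x - sph u x
    = norm x powr \<kappa> * (euler (euler f) x + s * euler f x + s * g x + (2 - \<gamma>) * g x
        - (n + \<gamma> - 4) * (n - \<gamma>) / 4 * f x - sph f x)"
    unfolding du dil[OF Cg] eg unfolding u_def \<kappa>_def[symmetric] sph_radial_powr_mult[OF C]
    by (simp add: radial_mult_def algebra_simps)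
  also have "\<dots> = norm x powr \<kappa> * (euler (euler f) x + (n - 2) * euler f x - sph f x)"
    by (rule arg_cong[of _ _ "\<lambda>t. norm x powr \<kappa> * t"]) (simp add: g_def s_def field_simps)
  also have "\<dots> = norm x powr \<kappa> * ((norm x)\<^sup>2 * L)"
    using laplacian_split[OF C, of x] by (simp add: n_def L_def)
  finally have "(dil (dil u) x + (2 - \<gamma>) * dil u x - (n + \<gamma> - 4) * (n - \<gamma>) / 4 * u x - sph u x)\<^sup>2
      = (norm x powr \<kappa>)\<^sup>2 * ((norm x)\<^sup>2)\<^sup>2 * L\<^sup>2" by (simp add: power_mult_distrib)
  also have "(norm x powr \<kappa>)\<^sup>2 * ((norm x)\<^sup>2)\<^sup>2 = norm x powr \<gamma>"
  proof (cases "x = 0")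
    case False
    have "(norm x powr \<kappa>)\<^sup>2 = norm x powr (\<kappa> + \<kappa>)"
      by (simp only: powr_add power2_eq_square)
    moreover have "((norm x)\<^sup>2)\<^sup>2 = norm x powr 4" using False by simp
    ultimately have "(norm x powr \<kappa>)\<^sup>2 * ((norm x)\<^sup>2)\<^sup>2 = norm x powr (\<kappa> + \<kappa> + 4)"
      by (simp only: powr_add)
    moreover have "\<kappa> + \<kappa> + 4 = \<gamma>" by (simp add: \<kappa>_def)
    ultimately show ?thesis by (simp only:)
  qed simp
  finally show ?thesis by (simp add: L_def)
qed

text \<open>Subtracting \<open>s\<close> from \<open>dil\<close> leaves the weight times
  \<open>euler f\<close>. The rest is \<open>norm_gradient_split\<close>, with twice the exponent of
  the weight plus 2 equal to \<open>\<gamma> - 2\<close>.\<close>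

lemma weighted_gradient_eq:
  fixes f :: "real^'n \<Rightarrow> real" and \<gamma> :: real
  assumes C: "C_k_on 1 UNIV f"
  defines "u \<equiv> radial_mult ((\<gamma> - 4) / 2) f" and "n \<equiv> real CARD('n)"
  shows "norm x powr (\<gamma> - 2) * (\<Sum>i\<in>UNIV. (partial i f x)\<^sup>2)
    = (dil u x - (n + \<gamma> - 4) / 2 * u x)\<^sup>2 + (\<Sum>i\<in>UNIV. \<Sum>k\<in>UNIV. (rot i k u x)\<^sup>2) / 2"
proof -
  define \<kappa> where "\<kappa> = (\<gamma> - 4) / 2"
  have "dil u x - (n + \<gamma> - 4) / 2 * u x = norm x powr \<kappa> * euler f x"
    unfolding dil_def u_def \<kappa>_def[symmetric] euler_radial_mult[OF C] n_def[symmetric]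
    by (simp add: radial_mult_def \<kappa>_def field_simps)
  moreover have "rot i k u x = norm x powr \<kappa> * rot i k f x" for i k
    unfolding u_def \<kappa>_def[symmetric] rot_radial_mult[OF C] radial_mult_def ..
  ultimately have "(dil u x - (n + \<gamma> - 4) / 2 * u x)\<^sup>2 + (\<Sum>i\<in>UNIV. \<Sum>k\<in>UNIV. (rot i k u x)\<^sup>2) / 2
      = (norm x powr \<kappa>)\<^sup>2 * ((euler f x)\<^sup>2 + (\<Sum>i\<in>UNIV. \<Sum>k\<in>UNIV. (rot i k f x)\<^sup>2) / 2)"
    by (simp add: power_mult_distrib sum_distrib_left distrib_left)
  also have "\<dots> = ((norm x powr \<kappa>)\<^sup>2 * (norm x)\<^sup>2) * (\<Sum>i\<in>UNIV. (partial i f x)\<^sup>2)"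
    by (simp only: norm_gradient_split[symmetric] mult.assoc)
  also have "(norm x powr \<kappa>)\<^sup>2 * (norm x)\<^sup>2 = norm x powr (\<gamma> - 2)"
  proof (cases "x = 0")
    case False
    have "(norm x powr \<kappa>)\<^sup>2 = norm x powr (\<kappa> + \<kappa>)"
      by (simp only: powr_add power2_eq_square)
    moreover have "(norm x)\<^sup>2 = norm x powr 2" using False by simp
    ultimately have "(norm x powr \<kappa>)\<^sup>2 * (norm x)\<^sup>2 = norm x powr (\<kappa> + \<kappa> + 2)"
      by (simp only: powr_add)
    moreover have "\<kappa> + \<kappa> + 2 = \<gamma> - 2" by (simp add: \<kappa>_def)
    ultimately show ?thesis by (simp only:)
  qed simp
  finally show ?thesis ..
qed

text \<open>The weight is absorbed into \<open>u\<close>, which stays smooth because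
  \<open>f\<close> vanishes near 0. Integrability is recorded for adding the contributions of real
  and imaginary parts.\<close>

lemma rellich_hardy_real:
  fixes f :: "real^'n \<Rightarrow> real" and \<gamma> :: real
  assumes n: "CARD('n) \<ge> 2" and C: "\<And>k. C_k_on k UNIV f" and bs: "bounded_support f"
    and "a > 0" "\<forall>x. norm x < a \<longrightarrow> f x = 0"
  shows "(LINT x|lborel. norm x powr \<gamma> * (\<Sum>i\<in>UNIV. partial i (partial i f) x)\<^sup>2)
    \<ge> A_const CARD('n) \<gamma> * (LINT x|lborel. norm x powr (\<gamma> - 2) * (\<Sum>i\<in>UNIV. (partial i f x)\<^sup>2))" (is ?A)
    and "integrable lborel (\<lambda>x. norm x powr \<gamma> * (\<Sum>i\<in>UNIV. partial i (partial i f) x)\<^sup>2)" (is ?B)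
    and "integrable lborel (\<lambda>x. norm x powr (\<gamma> - 2) * (\<Sum>i\<in>UNIV. (partial i f x)\<^sup>2))" (is ?C)
proof -
  have a: "a > 0" "\<And>x. norm x < a \<Longrightarrow> f x = 0" using assms by auto
  define u where "u = radial_mult ((\<gamma> - 4) / 2) f"
  have Cu: "C_k_on k UNIV u" for k
    unfolding u_def by (rule C_k_on_radial_mult[OF C a])
  have bu: "bounded_support u"
    unfolding u_def radial_mult_def[abs_def] by (rule bounded_support_mult(2)[OF bs])
  show ?A
    unfolding weighted_laplacian_eq[OF C] weighted_gradient_eq[OF C]
    using dil_rellich_hardy[OF n Cu bu, of \<gamma>] unfolding u_def .
  have radial: "integrable lborel (\<lambda>x. norm x powr \<mu> * h x)"
    if h: "continuous_on UNIV h" "bounded_support h" "\<And>x. norm x < a \<Longrightarrow> h x = 0" for h :: "real^'n \<Rightarrow> real" and \<mu>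
  proof -
    have "continuous_on UNIV (radial_mult \<mu> h)"
      using C_k_on_radial_mult[of 0 h a \<mu>] h a by simp
    then show ?thesis
      unfolding radial_mult_def[abs_def]
      by (rule integrable_bounded_support[OF _ bounded_support_mult(2)[OF h(2)]])
  qed
  have op: "open {x::real^'n. norm x < a}" by (intro open_Collect_less continuous_intros)
  have p0: "partial i f x = 0" if "norm x < a" for i x
    by (rule partial_eq_0_of_open[OF op]) (use that a in auto)
  have pp0: "partial i (partial i f) x = 0" if "norm x < a" for i x
    by (rule partial_eq_0_of_open[OF op]) (use that p0 in auto)
  have c: "continuous_on UNIV (partial i f)" "continuous_on UNIV (partial i (partial i f))" for i
    using C_k_on_continuous[OF C_k_on_partial[OF C]] C_k_on_continuous[OF C_k_on_partial[OF C_k_on_partial[OF C]]] by auto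
  show ?B
  proof (rule radial)
    show "bounded_support (\<lambda>x. (\<Sum>i\<in>UNIV. partial i (partial i f) x)\<^sup>2)"
      unfolding power2_eq_square
      by (intro bounded_support_mult bounded_support_sum bounded_support_partial bs) auto
  qed (auto intro!: continuous_intros c simp: pp0)
  show ?C
  proof (rule radial)
    show "bounded_support (\<lambda>x. \<Sum>i\<in>UNIV. (partial i f x)\<^sup>2)"
      unfolding power2_eq_square
      by (intro bounded_support_mult bounded_support_sum bounded_support_partial bs) auto
  qed (auto intro!: continuous_intros c simp: p0)
qed

section \<open>From complex to real functions\<close>

lemma C0_infty_C_k_on_UNIV:
  assumes "f \<in> C0_infty \<Omega>" "open \<Omega>"
  shows "C_k_on k UNIV f"
proof -
  let ?T = "- closure {x. f x \<noteq> 0}"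
  have 1: "C_k_on k \<Omega> f" using assms by (simp add: C0_infty_def smooth_on_def)
  have T: "open ?T" by auto
  have 2: "C_k_on k ?T f"
    by (rule C_k_on_cong[OF T _ C_k_on_const[of k _ 0]]) (use closure_subset[of "{x. f x \<noteq> 0}"] in auto)
  \<comment> \<open>The closed support lies in \<open>\<Omega>\<close>, so smoothness on
    \<open>\<Omega>\<close> and vanishing off the support cover the whole space.\<close>
  have "\<Omega> \<union> ?T = UNIV" using assms by (auto simp: C0_infty_def)
  then show ?thesis using C_k_on_Un[OF assms(2) T 1 2] by simp
qed

lemma partial_deriv_Re_Im:
  assumes "C_k_on 1 UNIV f"
  shows "Re (partial_deriv j f x) = partial j (\<lambda>x. Re (f x)) x"
    and "Im (partial_deriv j f x) = partial j (\<lambda>x. Im (f x)) x"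
proof -
  have d: "(f has_derivative frechet_derivative f (at x)) (at x)"
    using C_k_on_has_derivative[of 0 UNIV f x] assms by simp
  show "Re (partial_deriv j f x) = partial j (\<lambda>x. Re (f x)) x"
    using partial_eqI[OF bounded_linear.has_derivative[OF bounded_linear_Re d]] by (simp add: partial_deriv_def)
  show "Im (partial_deriv j f x) = partial j (\<lambda>x. Im (f x)) x"
    using partial_eqI[OF bounded_linear.has_derivative[OF bounded_linear_Im d]] by (simp add: partial_deriv_def)
qed

lemma laplacian_Re_Im:
  assumes "C_k_on 2 UNIV f"
  shows "(norm (laplacian f x))\<^sup>2 = (\<Sum>j\<in>UNIV. partial j (partial j (\<lambda>x. Re (f x))) x)\<^sup>2
    + (\<Sum>j\<in>UNIV. partial j (partial j (\<lambda>x. Im (f x))) x)\<^sup>2"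
proof -
  have 1: "C_k_on 1 UNIV f" using assms by (rule C_k_on_1_of_2)
  have 2: "C_k_on 1 UNIV (partial_deriv j f)" for j
    using assms by (simp add: numeral_2_eq_2 partial_deriv_def[abs_def])
  show ?thesis
    unfolding cmod_power2 laplacian_def Re_sum Im_sum partial_deriv_Re_Im[OF 2] partial_deriv_Re_Im[OF 1] ..
qed

lemma gradient_Re_Im:
  assumes "C_k_on 1 UNIV f"
  shows "(norm (gradient f x))\<^sup>2 = (\<Sum>j\<in>UNIV. (partial j (\<lambda>x. Re (f x)) x)\<^sup>2)
    + (\<Sum>j\<in>UNIV. (partial j (\<lambda>x. Im (f x)) x)\<^sup>2)"
  by (simp add: norm_vec_def L2_set_def sum_nonneg gradient_def cmod_power2 partial_deriv_Re_Im[OF assms] sum.distrib)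

theorem theoremA4:
  fixes \<gamma> :: real and f :: "real^'n \<Rightarrow> complex"
  assumes "CARD('n) \<ge> 2"
    and "f \<in> C0_infty (UNIV - {0})"
  shows "(LINT x|lborel. norm x powr \<gamma> * (norm (laplacian f x))\<^sup>2)
    \<ge> A_const CARD('n) \<gamma> * (LINT x|lborel. norm x powr (\<gamma> - 2) * (norm (gradient f x))\<^sup>2)"
proof -
  \<comment> \<open>Squared norms split into real and imaginary parts, so both sides are sums and
    the real inequality is applied to each part.\<close>
  define u v where "u = (\<lambda>x. Re (f x))" and "v = (\<lambda>x. Im (f x))"
  have C: "C_k_on k UNIV f" for k
    by (rule C0_infty_C_k_on_UNIV[OF assms(2)]) auto
  have Cu: "C_k_on k UNIV u" and Cv: "C_k_on k UNIV v" for k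
    unfolding u_def v_def
    by (rule C_k_on_bounded_linear_comp[OF bounded_linear_Re open_UNIV C]
        C_k_on_bounded_linear_comp[OF bounded_linear_Im open_UNIV C])+
  let ?K = "closure {x. f x \<noteq> 0}"
  have K: "compact ?K" "0 \<notin> ?K" using assms(2) by (auto simp: C0_infty_def)
  have "bounded ?K" by (rule compact_imp_bounded[OF K(1)])
  then obtain B where "\<forall>x\<in>?K. norm x \<le> B" unfolding bounded_iff by blast
  then have "norm x \<le> B" if "f x \<noteq> 0" for x
    using that closure_subset[of "{x. f x \<noteq> 0}"] by blast
  then have bs: "bounded_support u" "bounded_support v"
    unfolding bounded_support_def u_def v_def by (metis zero_complex.sel)+
  have "open (- ?K)" by auto
  \<comment> \<open>The support is closed and misses 0, so \<open>f\<close> vanishes on a ball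
    around the possible singularity of the weights.\<close>
  then obtain a where a: "a > 0" "ball 0 a \<subseteq> - ?K" using K(2) open_contains_ball by blast
  have "f x = 0" if "norm x < a" for x
    using a(2) that closure_subset[of "{x. f x \<noteq> 0}"] by auto
  then have z: "\<forall>x. norm x < a \<longrightarrow> u x = 0" "\<forall>x. norm x < a \<longrightarrow> v x = 0"
    by (simp_all add: u_def v_def)
  note hu = rellich_hardy_real[OF assms(1) Cu bs(1) a(1) z(1), of \<gamma>]
  note hv = rellich_hardy_real[OF assms(1) Cv bs(2) a(1) z(2), of \<gamma>]
  show ?thesis
    unfolding laplacian_Re_Im[OF C] gradient_Re_Im[OF C] u_def[symmetric] v_def[symmetric] distrib_left
      Bochner_Integration.integral_add[OF hu(2) hv(2)] Bochner_Integration.integral_add[OF hu(3) hv(3)]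
    using hu(1) hv(1) by linarith
qed

end
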